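(* Orbifold atlases (as objects), compatible systems (as 1-morphisms), natural transformations of compatible systems (as 2-morphisms), together with the compositions $\circ$ (of compatible systems), $\odot$ (vertical) and $\ast$ (horizontal) of natural transformations, and the identities $1_{\mathcal U}$, $i_{\tilde f}$, all as defined in the context, form a (strict) 2-category, denoted $(\textbf{Pre-Orb})$.
   Context: 2-categories are meant in the strict sense (composition of 1-morphisms and horizontal composition of 2-morphisms are strictly associative and unital, and composition is a functor between hom-categories). ATLASES. Let $X$ be a paracompact second countable Hausdorff space and $U\subseteq X$ open and non-empty. A (reduced complex) uniformizing system of dimension $n$ for $U$ is a triple $(\widetilde U,G,\pi)$ where $\widetilde U\subseteq\mathbb C^n$ is a non-empty connected open set, $G$ is a finite group of holomorphic automorphisms of $\widetilde U$ ($G$ is a set of maps), and $\pi:\widetilde U\to U$ is continuous, surjective, $G$-invariant and induces a homeomorphism $\widetilde U/G\to U$. An embedding from $(\widetilde U,G,\pi)$ (for $U$) to $(\widetilde V,H,\phi)$ (for $V$, with $U\subseteq V$) is a holomorphic embedding $\lambda:\widetilde U\to\widetilde V$ with $\phi\circ\lambda=\pi$. A (reduced complex) orbifold atlas of dimension $n$ on $X$ is a family $\mathcal U=\{(\widetilde U_i,G_i,\pi_i)\}_{i\in I}$ of uniformizing systems of dimension $n$ for open sets $U_i=\pi_i(\widetilde U_i)$ of $X$ such that (i) the $U_i$ cover $X$; (ii) for all $i,j\in I$ and $x\in U_i\cap U_j$ there are an open neighborhood $U_k\subseteq U_i\cap U_j$ of $x$, a uniformizing system $(\widetilde U_k,G_k,\pi_k)\in\mathcal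 U$ for $U_k$, and embeddings $\lambda_{ki}$, $\lambda_{kj}$ of it into $(\widetilde U_i,G_i,\pi_i)$ and $(\widetilde U_j,G_j,\pi_j)$. An atlas is also regarded as a category: objects are its uniformizing systems, morphisms are all embeddings between them. COMPATIBLE SYSTEMS. Let $\mathcal U$, $\mathcal V$ be atlases on $X$, $Y$ (not necessarily of the same dimension) and $f:X\to Y$ continuous. A compatible system $\tilde f:\mathcal U\to\mathcal V$ for $f$ consists of (1) a functor $\tilde f:\mathcal U\to\mathcal V$ such that, writing $(\widetilde V_i,H_i,\phi_i)$ for the image of $(\widetilde U_i,G_i,\pi_i)$, one has $f(\pi_i(\widetilde U_i))\subseteq\phi_i(\widetilde V_i)$; (2) for each $(\widetilde U_i,G_i,\pi_i)\in\mathcal U$ a holomorphic map $\tilde f_{\widetilde U_i,\widetilde V_i}:\widetilde U_i\to\widetilde V_i$ with $\phi_i\circ\tilde f_{\widetilde U_i,\widetilde V_i}=f\circ\pi_i$; such that $\tilde f_{\widetilde U_j,\widetilde V_j}\circ\lambda_{ij}=\tilde f(\lambda_{ij})\circ\tilde f_{\widetilde U_i,\widetilde V_i}$ for every embedding $\lambda_{ij}:(\widetilde U_i,G_i,\pi_i)\to(\widetilde U_j,G_j,\pi_j)$ in $\mathcal U$. The morphisms $\mathcal U\to\mathcal V$ are all compatible systems for all continuous maps $f:X\to Y$. Composition of $\tilde f:\mathcal U\to\mathcal V$ (for $f$) and $\tilde g:\mathcal V\to\mathcal W$ (for $g$): the compatible system $\tilde g\circ\tilde f$ for $g\circ f$ given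 by the composite functor with liftings $\tilde g_{\widetilde V_i,\widetilde W_i}\circ\tilde f_{\widetilde U_i,\widetilde V_i}$. Identity $1_{\mathcal U}$: the identity functor with liftings $1_{\widetilde U_i}$ (for the identity of $X$). NATURAL TRANSFORMATIONS. For compatible systems $\tilde f_1,\tilde f_2:\mathcal U\to\mathcal V$ for the same $f$, write $(\widetilde V_i^m,H_i^m,\phi_i^m)=\tilde f_m(\widetilde U_i,G_i,\pi_i)$ and $\lambda_{ij}^m=\tilde f_m(\lambda_{ij})$, $m=1,2$. A natural transformation $\delta:\tilde f_1\Rightarrow\tilde f_2$ is a family of embeddings $\delta_{\widetilde U_i}:(\widetilde V_i^1,H_i^1,\phi_i^1)\to(\widetilde V_i^2,H_i^2,\phi_i^2)$ in $\mathcal V$, one for each element of $\mathcal U$, with (i) $(\tilde f_2)_{\widetilde U_i,\widetilde V_i^2}=\delta_{\widetilde U_i}\circ(\tilde f_1)_{\widetilde U_i,\widetilde V_i^1}$ for all $i$; (ii) $\lambda_{ij}^2\circ\delta_{\widetilde U_i}=\delta_{\widetilde U_j}\circ\lambda_{ij}^1$ for every embedding $\lambda_{ij}$ in $\mathcal U$. There are no 2-morphisms between compatible systems for different continuous maps. Vertical composition of $\delta:\tilde f_1\Rightarrow\tilde f_2$, $\sigma:\tilde f_2\Rightarrow\tilde f_3$: $(\sigma\odot\delta)_{\widetilde U_i}=\sigma_{\widetilde U_i}\circ\delta_{\widetilde U_i}$. Identities: $(i_{\tilde f})_{\widetilde U_i}=1_{\widetilde V_i}$, and $i_{\mathcal U}=i_{1_{\mathcal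 U}}$. Horizontal composition of $\delta:\tilde f_1\Rightarrow\tilde f_2:\mathcal U\to\mathcal V$ and $\eta:\tilde g_1\Rightarrow\tilde g_2:\mathcal V\to\mathcal W$: $(\eta\ast\delta)_{\widetilde U_i}=\eta_{\widetilde V_i^2}\circ\tilde g_1(\delta_{\widetilde U_i})$, a natural transformation $\tilde g_1\circ\tilde f_1\Rightarrow\tilde g_2\circ\tilde f_2$. *)

theory Defs
  imports "HOL-Analysis.Analysis" "HOL-Algebra.Bij"
begin

section \<open>Categories, functors and strict 2-categories\<close>

text \<open>
  Hom-sets are families indexed by source and target. They are not required to be disjoint, so
  composition also takes the objects involved as arguments. Composition is written in
  applicative order: \<open>c_comp C a b c g f\<close> is \<open>g \<circ> f\<close> for \<open>f : a \<rightarrow> b\<close> and \<open>g : b \<rightarrow> c\<close>.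
\<close>

record ('o, 'm) cat =
  c_obj :: "'o set"
  c_hom :: "'o \<Rightarrow> 'o \<Rightarrow> 'm set"
  c_comp :: "'o \<Rightarrow> 'o \<Rightarrow> 'o \<Rightarrow> 'm \<Rightarrow> 'm \<Rightarrow> 'm"
  c_id :: "'o \<Rightarrow> 'm"

definition is_category :: "('o, 'm) cat \<Rightarrow> bool" where
  "is_category C \<longleftrightarrow>
     (\<forall>a\<in>c_obj C. c_id C a \<in> c_hom C a a) \<and>
     (\<forall>a\<in>c_obj C. \<forall>b\<in>c_obj C. \<forall>c\<in>c_obj C. \<forall>f\<in>c_hom C a b. \<forall>g\<in>c_hom C b c.
        c_comp C a b c g f \<in> c_hom C a c) \<and>
     (\<forall>a\<in>c_obj C. \<forall>b\<in>c_obj C. \<forall>f\<in>c_hom C a b.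
        c_comp C a a b f (c_id C a) = f \<and> c_comp C a b b (c_id C b) f = f) \<and>
     (\<forall>a\<in>c_obj C. \<forall>b\<in>c_obj C. \<forall>c\<in>c_obj C. \<forall>d\<in>c_obj C.
        \<forall>f\<in>c_hom C a b. \<forall>g\<in>c_hom C b c. \<forall>h\<in>c_hom C c d.
        c_comp C a c d h (c_comp C a b c g f) = c_comp C a b d (c_comp C b c d h g) f)"

definition is_functor ::
  "('o, 'm) cat \<Rightarrow> ('p, 'n) cat \<Rightarrow> ('o \<Rightarrow> 'p) \<Rightarrow> ('o \<Rightarrow> 'o \<Rightarrow> 'm \<Rightarrow> 'n) \<Rightarrow> bool" where
  "is_functor C D Fo Fa \<longleftrightarrow>
     (\<forall>a\<in>c_obj C. Fo a \<in> c_obj D) \<and>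
     (\<forall>a\<in>c_obj C. \<forall>b\<in>c_obj C. \<forall>f\<in>c_hom C a b. Fa a b f \<in> c_hom D (Fo a) (Fo b)) \<and>
     (\<forall>a\<in>c_obj C. Fa a a (c_id C a) = c_id D (Fo a)) \<and>
     (\<forall>a\<in>c_obj C. \<forall>b\<in>c_obj C. \<forall>c\<in>c_obj C. \<forall>f\<in>c_hom C a b. \<forall>g\<in>c_hom C b c.
        Fa a c (c_comp C a b c g f) = c_comp D (Fo a) (Fo b) (Fo c) (Fa b c g) (Fa a b f))"

definition prod_cat :: "('o, 'm) cat \<Rightarrow> ('p, 'n) cat \<Rightarrow> ('o \<times> 'p, 'm \<times> 'n) cat" where
  "prod_cat C D =
     \<lparr>c_obj = c_obj C \<times> c_obj D,
      c_hom = (\<lambda>(a, a') (b, b'). c_hom C a b \<times> c_hom D a' b'),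
      c_comp = (\<lambda>(a, a') (b, b') (c, c') (g, g') (f, f').
                  (c_comp C a b c g f, c_comp D a' b' c' g' f')),
      c_id = (\<lambda>(a, a'). (c_id C a, c_id D a'))\<rparr>"

text \<open>
  In a 2-category, \<open>t_hom T a b\<close> is the hom-category of 1-morphisms \<open>a \<rightarrow> b\<close>; its composition is
  the vertical one and its identities are the identity 2-morphisms.
  \<open>t_comp T a b c g f\<close> is \<open>g \<circ> f\<close>, and \<open>t_hcomp T a b c g1 f1 g2 f2 \<eta> \<delta>\<close> is \<open>\<eta> \<ast> \<delta>\<close> for
  \<open>\<delta> : f1 \<Rightarrow> f2 : a \<rightarrow> b\<close> and \<open>\<eta> : g1 \<Rightarrow> g2 : b \<rightarrow> c\<close>.
\<close>

record ('o, 'm, 't) two_cat =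
  t_obj :: "'o set"
  t_hom :: "'o \<Rightarrow> 'o \<Rightarrow> ('m, 't) cat"
  t_comp :: "'o \<Rightarrow> 'o \<Rightarrow> 'o \<Rightarrow> 'm \<Rightarrow> 'm \<Rightarrow> 'm"
  t_hcomp :: "'o \<Rightarrow> 'o \<Rightarrow> 'o \<Rightarrow> 'm \<Rightarrow> 'm \<Rightarrow> 'm \<Rightarrow> 'm \<Rightarrow> 't \<Rightarrow> 't \<Rightarrow> 't"
  t_id :: "'o \<Rightarrow> 'm"

text \<open>
  The functoriality clause contains the typing of both compositions, the interchange law and the
  compatibility of horizontal composition with identity 2-morphisms.
\<close>

definition strict_2_category :: "('o, 'm, 't) two_cat \<Rightarrow> bool" where
  "strict_2_category T \<longleftrightarrow>
     (\<forall>a\<in>t_obj T. \<forall>b\<in>t_obj T. is_category (t_hom T a b)) \<and>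
     (\<forall>a\<in>t_obj T. t_id T a \<in> c_obj (t_hom T a a)) \<and>
     (\<forall>a\<in>t_obj T. \<forall>b\<in>t_obj T. \<forall>c\<in>t_obj T.
        is_functor (prod_cat (t_hom T b c) (t_hom T a b)) (t_hom T a c)
          (\<lambda>(g, f). t_comp T a b c g f)
          (\<lambda>(g1, f1) (g2, f2) (\<eta>, \<delta>). t_hcomp T a b c g1 f1 g2 f2 \<eta> \<delta>)) \<and>
     (\<forall>a\<in>t_obj T. \<forall>b\<in>t_obj T. \<forall>f\<in>c_obj (t_hom T a b).
        t_comp T a a b f (t_id T a) = f \<and> t_comp T a b b (t_id T b) f = f) \<and>
     (\<forall>a\<in>t_obj T. \<forall>b\<in>t_obj T. \<forall>c\<in>t_obj T. \<forall>d\<in>t_obj T.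
        \<forall>f\<in>c_obj (t_hom T a b). \<forall>g\<in>c_obj (t_hom T b c). \<forall>h\<in>c_obj (t_hom T c d).
        t_comp T a c d h (t_comp T a b c g f) = t_comp T a b d (t_comp T b c d h g) f) \<and>
     (\<forall>a\<in>t_obj T. \<forall>b\<in>t_obj T. \<forall>f1\<in>c_obj (t_hom T a b). \<forall>f2\<in>c_obj (t_hom T a b).
        \<forall>\<delta>\<in>c_hom (t_hom T a b) f1 f2.
        t_hcomp T a a b f1 (t_id T a) f2 (t_id T a) \<delta> (c_id (t_hom T a a) (t_id T a)) = \<delta> \<and>
        t_hcomp T a b b (t_id T b) f1 (t_id T b) f2 (c_id (t_hom T b b) (t_id T b)) \<delta> = \<delta>) \<and>
     (\<forall>a\<in>t_obj T. \<forall>b\<in>t_obj T. \<forall>c\<in>t_obj T. \<forall>d\<in>t_obj T.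
        \<forall>f1\<in>c_obj (t_hom T a b). \<forall>f2\<in>c_obj (t_hom T a b).
        \<forall>g1\<in>c_obj (t_hom T b c). \<forall>g2\<in>c_obj (t_hom T b c).
        \<forall>h1\<in>c_obj (t_hom T c d). \<forall>h2\<in>c_obj (t_hom T c d).
        \<forall>\<delta>\<in>c_hom (t_hom T a b) f1 f2. \<forall>\<eta>\<in>c_hom (t_hom T b c) g1 g2.
        \<forall>\<zeta>\<in>c_hom (t_hom T c d) h1 h2.
        t_hcomp T a c d h1 (t_comp T a b c g1 f1) h2 (t_comp T a b c g2 f2)
          \<zeta> (t_hcomp T a b c g1 f1 g2 f2 \<eta> \<delta>) =
        t_hcomp T a b d (t_comp T b c d h1 g1) f1 (t_comp T b c d h2 g2) f2
          (t_hcomp T b c d h1 g1 h2 g2 \<zeta> \<eta>) \<delta>)"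


section \<open>Holomorphic maps between open subsets of complex n-space\<close>

text \<open>
  The dimension varies from atlas to atlas, so a point of \<open>\<complex>\<^sup>n\<close> is a function on \<open>{..<n}\<close>,
  extended by \<open>undefined\<close>. In the same way all maps with a given domain are represented by
  functions that are extensional on it, so that equality of maps is equality in HOL.
\<close>

type_synonym cvec = "nat \<Rightarrow> complex"

definition Cn :: "nat \<Rightarrow> cvec topology" where
  "Cn n = product_topology (\<lambda>_. euclidean) {..<n}"

text \<open>\<open>f\<close> is complex (Frechet) differentiable at \<open>z\<close> with Jacobian matrix \<open>J\<close> (of size \<open>m \<times> n\<close>).\<close>

definition has_jacobian ::
  "nat \<Rightarrow> nat \<Rightarrow> (cvec \<Rightarrow> cvec) \<Rightarrow> (nat \<Rightarrow> nat \<Rightarrow> complex) \<Rightarrow> cvec \<Rightarrow> bool" where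
  "has_jacobian n m f J z \<longleftrightarrow>
     (\<forall>j<m. ((\<lambda>w. (f w j - f z j - (\<Sum>i<n. J j i * (w i - z i)))
                   / complex_of_real (L2_set (\<lambda>i. cmod (w i - z i)) {..<n})) \<longlongrightarrow> 0)
              (atin (Cn n) z))"

definition holomorphic_map :: "nat \<Rightarrow> nat \<Rightarrow> cvec set \<Rightarrow> cvec set \<Rightarrow> (cvec \<Rightarrow> cvec) \<Rightarrow> bool" where
  "holomorphic_map n m U V f \<longleftrightarrow> f \<in> U \<rightarrow>\<^sub>E V \<and> (\<forall>z\<in>U. \<exists>J. has_jacobian n m f J z)"

text \<open>A holomorphic embedding is a holomorphic immersion that is a topological embedding.\<close>

definition holomorphic_embedding ::
  "nat \<Rightarrow> nat \<Rightarrow> cvec set \<Rightarrow> cvec set \<Rightarrow> (cvec \<Rightarrow> cvec) \<Rightarrow> bool" where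
  "holomorphic_embedding n m U V f \<longleftrightarrow>
     holomorphic_map n m U V f \<and>
     embedding_map (subtopology (Cn n) U) (subtopology (Cn m) V) f \<and>
     (\<forall>z\<in>U. \<exists>J. has_jacobian n m f J z \<and>
        (\<forall>h\<in>topspace (Cn n). (\<forall>j<m. (\<Sum>i<n. J j i * h i) = 0) \<longrightarrow> (\<forall>i<n. h i = 0)))"

definition holomorphic_auts :: "nat \<Rightarrow> cvec set \<Rightarrow> (cvec \<Rightarrow> cvec) set" where
  "holomorphic_auts n U =
     {g \<in> Bij U. holomorphic_map n n U U g \<and>
                 holomorphic_map n n U U (restrict (inv_into U g) U)}"


section \<open>Orbifold atlases\<close>

definition paracompact_space :: "'a topology \<Rightarrow> bool" where
  "paracompact_space X \<longleftrightarrow>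
     (\<forall>\<U>. (\<forall>U\<in>\<U>. openin X U) \<and> \<Union>\<U> = topspace X \<longrightarrow>
        (\<exists>\<V>. (\<forall>V\<in>\<V>. openin X V) \<and> \<Union>\<V> = topspace X \<and> (\<forall>V\<in>\<V>. \<exists>U\<in>\<U>. V \<subseteq> U) \<and>
              locally_finite_in X \<V>))"

record 'a unif_sys =
  us_dom :: "cvec set"
  us_grp :: "(cvec \<Rightarrow> cvec) set"
  us_proj :: "cvec \<Rightarrow> 'a"

definition us_image :: "'a unif_sys \<Rightarrow> 'a set" where
  "us_image s = us_proj s ` us_dom s"

definition orbit_of :: "('b \<Rightarrow> 'b) set \<Rightarrow> 'b \<Rightarrow> 'b set" where
  "orbit_of G x = (\<lambda>g. g x) ` G"

definition orbit_space :: "'b topology \<Rightarrow> ('b \<Rightarrow> 'b) set \<Rightarrow> 'b set topology" where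
  "orbit_space Y G =
     topology (\<lambda>T. T \<subseteq> orbit_of G ` topspace Y \<and> openin Y {x \<in> topspace Y. orbit_of G x \<in> T})"

lemma openin_orbit_space:
  "openin (orbit_space Y G) T \<longleftrightarrow>
     T \<subseteq> orbit_of G ` topspace Y \<and> openin Y {x \<in> topspace Y. orbit_of G x \<in> T}"
proof -
  let ?P = "\<lambda>T. T \<subseteq> orbit_of G ` topspace Y \<and> openin Y {x \<in> topspace Y. orbit_of G x \<in> T}"
  have "istopology ?P"
    unfolding istopology_def
  proof (intro conjI allI impI)
    fix S T assume "?P S" "?P T"
    moreover have "{x \<in> topspace Y. orbit_of G x \<in> S \<inter> T} =
        {x \<in> topspace Y. orbit_of G x \<in> S} \<inter> {x \<in> topspace Y. orbit_of G x \<in> T}"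
      by auto
    ultimately show "S \<inter> T \<subseteq> orbit_of G ` topspace Y"
      and "openin Y {x \<in> topspace Y. orbit_of G x \<in> S \<inter> T}"
      by auto
  next
    fix K assume K: "\<forall>T\<in>K. ?P T"
    then show "\<Union>K \<subseteq> orbit_of G ` topspace Y"
      by blast
    have "{x \<in> topspace Y. orbit_of G x \<in> \<Union>K} =
        (\<Union>T\<in>K. {x \<in> topspace Y. orbit_of G x \<in> T})"
      by auto
    then show "openin Y {x \<in> topspace Y. orbit_of G x \<in> \<Union>K}"
      using K by auto
  qed
  then show ?thesis
    by (simp add: orbit_space_def topology_inverse')
qed

definition uniformizing_system :: "nat \<Rightarrow> 'a topology \<Rightarrow> 'a set \<Rightarrow> 'a unif_sys \<Rightarrow> bool" where
  "uniformizing_system n X U s \<longleftrightarrow>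
     openin X U \<and> U \<noteq> {} \<and>
     openin (Cn n) (us_dom s) \<and> connectedin (Cn n) (us_dom s) \<and> us_dom s \<noteq> {} \<and>
     finite (us_grp s) \<and> us_grp s \<subseteq> holomorphic_auts n (us_dom s) \<and>
     subgroup (us_grp s) (BijGroup (us_dom s)) \<and>
     us_proj s \<in> extensional (us_dom s) \<and>
     continuous_map (subtopology (Cn n) (us_dom s)) (subtopology X U) (us_proj s) \<and>
     us_proj s ` us_dom s = U \<and>
     (\<forall>g\<in>us_grp s. \<forall>x\<in>us_dom s. us_proj s (g x) = us_proj s x) \<and>
     (\<exists>h. homeomorphic_map (orbit_space (subtopology (Cn n) (us_dom s)) (us_grp s))
                           (subtopology X U) h \<and>
          (\<forall>x\<in>us_dom s. h (orbit_of (us_grp s) x) = us_proj s x))"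

definition embeddings :: "nat \<Rightarrow> 'a unif_sys \<Rightarrow> 'a unif_sys \<Rightarrow> (cvec \<Rightarrow> cvec) set" where
  "embeddings n s t =
     {e. us_image s \<subseteq> us_image t \<and>
         holomorphic_embedding n n (us_dom s) (us_dom t) e \<and>
         (\<forall>x\<in>us_dom s. us_proj t (e x) = us_proj s x)}"

record 'a atlas =
  at_space :: "'a topology"
  at_dim :: nat
  at_charts :: "'a unif_sys set"

definition orbifold_atlas :: "'a atlas \<Rightarrow> bool" where
  "orbifold_atlas A \<longleftrightarrow>
     paracompact_space (at_space A) \<and> second_countable (at_space A) \<and>
     Hausdorff_space (at_space A) \<and>
     (\<forall>s\<in>at_charts A. uniformizing_system (at_dim A) (at_space A) (us_image s) s) \<and>
     (\<Union>s\<in>at_charts A. us_image s) = topspace (at_space A) \<and>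
     (\<forall>s\<in>at_charts A. \<forall>t\<in>at_charts A. \<forall>x\<in>us_image s \<inter> us_image t.
        \<exists>k\<in>at_charts A. x \<in> us_image k \<and> us_image k \<subseteq> us_image s \<inter> us_image t \<and>
          embeddings (at_dim A) k s \<noteq> {} \<and> embeddings (at_dim A) k t \<noteq> {})"

definition atlas_cat :: "'a atlas \<Rightarrow> ('a unif_sys, cvec \<Rightarrow> cvec) cat" where
  "atlas_cat A =
     \<lparr>c_obj = at_charts A,
      c_hom = embeddings (at_dim A),
      c_comp = (\<lambda>s t u e2 e1. compose (us_dom s) e2 e1),
      c_id = (\<lambda>s. \<lambda>x\<in>us_dom s. x)\<rparr>"


section \<open>Compatible systems\<close>

record 'a csys =
  cs_base :: "'a \<Rightarrow> 'a"
  cs_obj :: "'a unif_sys \<Rightarrow> 'a unif_sys"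
  cs_arr :: "'a unif_sys \<Rightarrow> 'a unif_sys \<Rightarrow> (cvec \<Rightarrow> cvec) \<Rightarrow> (cvec \<Rightarrow> cvec)"
  cs_lift :: "'a unif_sys \<Rightarrow> (cvec \<Rightarrow> cvec)"

definition compatible_system :: "'a atlas \<Rightarrow> 'a atlas \<Rightarrow> 'a csys \<Rightarrow> bool" where
  "compatible_system A B f \<longleftrightarrow>
     continuous_map (at_space A) (at_space B) (cs_base f) \<and>
     is_functor (atlas_cat A) (atlas_cat B) (cs_obj f) (cs_arr f) \<and>
     (\<forall>s\<in>at_charts A. cs_base f ` us_image s \<subseteq> us_image (cs_obj f s)) \<and>
     (\<forall>s\<in>at_charts A.
        holomorphic_map (at_dim A) (at_dim B) (us_dom s) (us_dom (cs_obj f s)) (cs_lift f s) \<and>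
        (\<forall>x\<in>us_dom s. us_proj (cs_obj f s) (cs_lift f s x) = cs_base f (us_proj s x))) \<and>
     (\<forall>s\<in>at_charts A. \<forall>t\<in>at_charts A. \<forall>e\<in>embeddings (at_dim A) s t.
        compose (us_dom s) (cs_lift f t) e = compose (us_dom s) (cs_arr f s t e) (cs_lift f s)) \<and>
     \<comment> \<open>extensionality of the data\<close>
     cs_base f \<in> extensional (topspace (at_space A)) \<and>
     cs_obj f \<in> extensional (at_charts A) \<and>
     cs_lift f \<in> extensional (at_charts A) \<and>
     (\<forall>s t e. \<not> (s \<in> at_charts A \<and> t \<in> at_charts A \<and> e \<in> embeddings (at_dim A) s t) \<longrightarrow>
        cs_arr f s t e = undefined)"

definition cs_comp :: "'a atlas \<Rightarrow> 'a csys \<Rightarrow> 'a csys \<Rightarrow> 'a csys" where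
  "cs_comp A g f =
     \<lparr>cs_base = compose (topspace (at_space A)) (cs_base g) (cs_base f),
      cs_obj = compose (at_charts A) (cs_obj g) (cs_obj f),
      cs_arr = (\<lambda>s t e.
        if s \<in> at_charts A \<and> t \<in> at_charts A \<and> e \<in> embeddings (at_dim A) s t
        then cs_arr g (cs_obj f s) (cs_obj f t) (cs_arr f s t e) else undefined),
      cs_lift = (\<lambda>s\<in>at_charts A. compose (us_dom s) (cs_lift g (cs_obj f s)) (cs_lift f s))\<rparr>"

definition cs_id :: "'a atlas \<Rightarrow> 'a csys" where
  "cs_id A =
     \<lparr>cs_base = (\<lambda>x\<in>topspace (at_space A). x),
      cs_obj = (\<lambda>s\<in>at_charts A. s),
      cs_arr = (\<lambda>s t e.
        if s \<in> at_charts A \<and> t \<in> at_charts A \<and> e \<in> embeddings (at_dim A) s t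
        then e else undefined),
      cs_lift = (\<lambda>s\<in>at_charts A. \<lambda>x\<in>us_dom s. x)\<rparr>"


section \<open>Natural transformations of compatible systems\<close>

type_synonym 'a ntrans = "'a unif_sys \<Rightarrow> (cvec \<Rightarrow> cvec)"

definition natural_transformation ::
  "'a atlas \<Rightarrow> 'a atlas \<Rightarrow> 'a csys \<Rightarrow> 'a csys \<Rightarrow> 'a ntrans \<Rightarrow> bool" where
  "natural_transformation A B f1 f2 \<delta> \<longleftrightarrow>
     cs_base f1 = cs_base f2 \<and>
     \<delta> \<in> extensional (at_charts A) \<and>
     (\<forall>s\<in>at_charts A. \<delta> s \<in> embeddings (at_dim B) (cs_obj f1 s) (cs_obj f2 s)) \<and>
     (\<forall>s\<in>at_charts A. cs_lift f2 s = compose (us_dom s) (\<delta> s) (cs_lift f1 s)) \<and>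
     (\<forall>s\<in>at_charts A. \<forall>t\<in>at_charts A. \<forall>e\<in>embeddings (at_dim A) s t.
        compose (us_dom (cs_obj f1 s)) (cs_arr f2 s t e) (\<delta> s) =
        compose (us_dom (cs_obj f1 s)) (\<delta> t) (cs_arr f1 s t e))"

definition nt_vcomp :: "'a atlas \<Rightarrow> 'a csys \<Rightarrow> 'a ntrans \<Rightarrow> 'a ntrans \<Rightarrow> 'a ntrans" where
  "nt_vcomp A f1 \<sigma> \<delta> = (\<lambda>s\<in>at_charts A. compose (us_dom (cs_obj f1 s)) (\<sigma> s) (\<delta> s))"

definition nt_id :: "'a atlas \<Rightarrow> 'a csys \<Rightarrow> 'a ntrans" where
  "nt_id A f = (\<lambda>s\<in>at_charts A. \<lambda>x\<in>us_dom (cs_obj f s). x)"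

definition nt_hcomp ::
  "'a atlas \<Rightarrow> 'a csys \<Rightarrow> 'a csys \<Rightarrow> 'a csys \<Rightarrow> 'a ntrans \<Rightarrow> 'a ntrans \<Rightarrow> 'a ntrans" where
  "nt_hcomp A g1 f1 f2 \<eta> \<delta> =
     (\<lambda>s\<in>at_charts A. compose (us_dom (cs_obj g1 (cs_obj f1 s)))
        (\<eta> (cs_obj f2 s)) (cs_arr g1 (cs_obj f1 s) (cs_obj f2 s) (\<delta> s)))"


section \<open>The 2-category of orbifold atlases\<close>

definition Pre_Orb :: "('a atlas, 'a csys, 'a ntrans) two_cat" where
  "Pre_Orb =
     \<lparr>t_obj = {A. orbifold_atlas A},
      t_hom = (\<lambda>A B.
        \<lparr>c_obj = {f. compatible_system A B f},
         c_hom = (\<lambda>f1 f2. {\<delta>. natural_transformation A B f1 f2 \<delta>}),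
         c_comp = (\<lambda>f1 f2 f3 \<sigma> \<delta>. nt_vcomp A f1 \<sigma> \<delta>),
         c_id = nt_id A\<rparr>),
      t_comp = (\<lambda>A B C g f. cs_comp A g f),
      t_hcomp = (\<lambda>A B C g1 f1 g2 f2 \<eta> \<delta>. nt_hcomp A g1 f1 f2 \<eta> \<delta>),
      t_id = cs_id\<rparr>"

end

theory Submission
  imports Defs
begin

text \<open>
  All data of the 2-category are maps between sets: charts, embeddings, liftings and components of
  natural transformations. Composition of maps is strictly associative and unital, so the axioms
  hold strictly as soon as two things are known: the compositions stay inside the classes of maps
  considered, and the few equations that involve more than associativity follow from naturality.

  The first point is analytic. The composite of holomorphic maps is holomorphic by the chain rule
  (\<open>has_jacobian_compose\<close>), and the composite of holomorphic embeddings is again one because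
  topological embeddings compose and a product of injective Jacobians is injective
  (\<open>holomorphic_embedding_compose\<close>). So an atlas is a category, compatible systems compose
  (\<open>compatible_system_comp\<close>) and natural transformations have embeddings as components.

  The second point is the usual calculus of natural transformations. The component of
  \<open>\<eta> \<ast> \<delta>\<close> at \<open>s\<close> is \<open>\<eta>\<close> at \<open>f\<^sub>2 s\<close> after \<open>g\<^sub>1\<close> of \<open>\<delta>\<close> at \<open>s\<close>; it is natural
  (\<open>natural_transformation_hcomp\<close>) since \<open>\<eta>\<close> is natural, \<open>g\<^sub>1\<close> is a functor and \<open>\<delta>\<close> is natural.
  The interchange law (\<open>nt_interchange\<close>) is the naturality square of \<open>\<eta>\<close> for the embedding given
  by a component of the second transformation, and associativity of horizontal composition
  (\<open>nt_hcomp_assoc\<close>) is the functoriality of the outermost system.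

  Since every map is extensional on its domain, equality of 1-morphisms and of 2-morphisms can be
  checked at points of the domains (\<open>csys_eqI\<close>, \<open>nt_eqI\<close>).
\<close>

section \<open>Holomorphic maps and the chain rule\<close>

definition Cn_dist :: "nat \<Rightarrow> cvec \<Rightarrow> cvec \<Rightarrow> real" where
  "Cn_dist n w z = L2_set (\<lambda>i. cmod (w i - z i)) {..<n}"

lemma Cn_dist_nonneg: "0 \<le> Cn_dist n w z"
  by (simp add: Cn_dist_def)

lemma Cn_dist_self [simp]: "Cn_dist n z z = 0"
  by (simp add: Cn_dist_def L2_set_def)

lemma topspace_Cn: "topspace (Cn n) = extensional {..<n}"
  by (simp add: Cn_def PiE_def)

lemma component_le_Cn_dist: "i < n \<Longrightarrow> cmod (w i - z i) \<le> Cn_dist n w z"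
  unfolding Cn_dist_def by (rule member_le_L2_set) auto

lemma Cn_dist_pos:
  assumes "w \<in> topspace (Cn n)" "z \<in> topspace (Cn n)" "w \<noteq> z"
  shows "0 < Cn_dist n w z"
proof -
  obtain i where "i < n" "w i \<noteq> z i"
    using assms by (metis topspace_Cn extensionalityI lessThan_iff)
  then show ?thesis
    using component_le_Cn_dist[of i n w z] by (smt (verit) zero_less_norm_iff right_minus_eq)
qed

text \<open>
  The product topology on finitely many coordinates is the metric topology of the Euclidean
  distance: the distance lies between the largest and the sum of the coordinate distances, so boxes
  and balls can be nested in each other. This turns limits in \<open>\<complex>\<^sup>n\<close> into estimates.
\<close>

lemma openin_Cn_iff:
  "openin (Cn n) T \<longleftrightarrow>
     T \<subseteq> topspace (Cn n) \<and>
     (\<forall>z\<in>T. \<exists>d>0. \<forall>w\<in>topspace (Cn n). Cn_dist n w z < d \<longrightarrow> w \<in> T)"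
  (is "?L \<longleftrightarrow> ?sub \<and> ?R")
proof (intro iffI conjI)
  assume T: ?L
  then show ?sub by (rule openin_subset)
  show ?R
  proof
    fix z assume z: "z \<in> T"
    have "\<forall>z\<in>T. \<exists>U. (\<forall>i\<in>{..<n}. open (U i)) \<and> z \<in> Pi\<^sub>E {..<n} U \<and> Pi\<^sub>E {..<n} U \<subseteq> T"
      using T by (simp add: Cn_def openin_product_topology_alt)
    then obtain U where U: "\<forall>i\<in>{..<n}. open (U i)" "z \<in> Pi\<^sub>E {..<n} U" "Pi\<^sub>E {..<n} U \<subseteq> T"
      using z by blast
    have "\<forall>i\<in>{..<n}. \<exists>d>0. ball (z i) d \<subseteq> U i"
      using U(1,2) by (auto simp: open_contains_ball)
    then obtain d where d: "\<And>i. i < n \<Longrightarrow> d i > 0 \<and> ball (z i) (d i) \<subseteq> U i"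
      by (metis lessThan_iff)
    define D where "D = Min (insert 1 (d ` {..<n}))"
    have "D > 0" using d by (auto simp: D_def)
    moreover have "w \<in> T" if w: "w \<in> topspace (Cn n)" "Cn_dist n w z < D" for w
    proof -
      have "w i \<in> U i" if i: "i < n" for i
      proof -
        have "cmod (w i - z i) < D" using component_le_Cn_dist[OF i, of w z] w(2) by simp
        also have "D \<le> d i" using i by (auto simp: D_def)
        finally show ?thesis using d[OF i] by (auto simp: dist_norm norm_minus_commute)
      qed
      then show ?thesis using U(3) w(1) by (auto simp: topspace_Cn PiE_def)
    qed
    ultimately show "\<exists>d>0. \<forall>w\<in>topspace (Cn n). Cn_dist n w z < d \<longrightarrow> w \<in> T" by blast
  qed
next
  assume R: "?sub \<and> ?R"
  show ?L
  proof (subst openin_subopen, intro ballI)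
    fix z assume z: "z \<in> T"
    then obtain d where d: "d > 0" "\<And>w. w \<in> topspace (Cn n) \<Longrightarrow> Cn_dist n w z < d \<Longrightarrow> w \<in> T"
      using R by blast
    define r where "r = d / (real n + 1)"
    have r: "r > 0" using d(1) by (simp add: r_def)
    let ?B = "Pi\<^sub>E {..<n} (\<lambda>i. ball (z i) r)"
    have "openin (Cn n) ?B"
      unfolding Cn_def by (simp add: openin_PiE)
    moreover have "z \<in> ?B" using R z r by (auto simp: topspace_Cn PiE_def)
    moreover have "?B \<subseteq> T"
    proof
      fix w assume w: "w \<in> ?B"
      have "Cn_dist n w z \<le> (\<Sum>i<n. cmod (w i - z i))"
        unfolding Cn_dist_def by (rule L2_set_le_sum) auto
      also have "\<dots> \<le> (\<Sum>i<n. r)"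
        using w by (intro sum_mono) (auto simp: PiE_def Pi_def dist_norm norm_minus_commute less_imp_le)
      also have "\<dots> < d" using d(1) by (simp add: r_def field_simps)
      finally show "w \<in> T" using d(2) w by (auto simp: topspace_Cn PiE_def)
    qed
    ultimately show "\<exists>B. openin (Cn n) B \<and> z \<in> B \<and> B \<subseteq> T" by blast
  qed
qed

text \<open>The remainder of component \<open>j\<close> in the first-order expansion of \<open>f\<close> at \<open>z\<close>.\<close>

definition lin_err :: "nat \<Rightarrow> (cvec \<Rightarrow> cvec) \<Rightarrow> (nat \<Rightarrow> nat \<Rightarrow> complex) \<Rightarrow> cvec \<Rightarrow> nat \<Rightarrow> cvec \<Rightarrow> complex" where
  "lin_err n f J z j w = f w j - f z j - (\<Sum>i<n. J j i * (w i - z i))"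

lemma eventually_atin_Cn:
  assumes "z \<in> topspace (Cn n)"
  shows "eventually P (atin (Cn n) z) \<longleftrightarrow>
     (\<exists>d>0. \<forall>w\<in>topspace (Cn n). w \<noteq> z \<and> Cn_dist n w z < d \<longrightarrow> P w)"
proof
  assume "eventually P (atin (Cn n) z)"
  then obtain T where "openin (Cn n) T" "z \<in> T" "\<forall>w\<in>T - {z}. P w"
    using assms by (auto simp: eventually_atin)
  then show "\<exists>d>0. \<forall>w\<in>topspace (Cn n). w \<noteq> z \<and> Cn_dist n w z < d \<longrightarrow> P w"
    by (metis openin_Cn_iff Diff_iff singletonD)
next
  assume "\<exists>d>0. \<forall>w\<in>topspace (Cn n). w \<noteq> z \<and> Cn_dist n w z < d \<longrightarrow> P w"
  then obtain d where d: "d > 0" "\<forall>w\<in>topspace (Cn n). w \<noteq> z \<and> Cn_dist n w z < d \<longrightarrow> P w" by blast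
  define T where "T = {w \<in> topspace (Cn n). Cn_dist n w z < d}"
  have "openin (Cn n) T"
    unfolding openin_Cn_iff
  proof (intro conjI ballI)
    show "T \<subseteq> topspace (Cn n)" by (auto simp: T_def)
    fix y assume y: "y \<in> T"
    have tri: "Cn_dist n w z \<le> Cn_dist n w y + Cn_dist n y z" for w
    proof -
      have "Cn_dist n w z \<le> L2_set (\<lambda>i. cmod (w i - y i) + cmod (y i - z i)) {..<n}"
        unfolding Cn_dist_def
        by (rule L2_set_mono) (auto intro: norm_diff_triangle_ineq order_trans[OF _ norm_triangle_ineq])
      also have "\<dots> \<le> Cn_dist n w y + Cn_dist n y z"
        unfolding Cn_dist_def by (rule L2_set_triangle_ineq)
      finally show ?thesis .
    qed
    show "\<exists>r>0. \<forall>w\<in>topspace (Cn n). Cn_dist n w y < r \<longrightarrow> w \<in> T"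
    proof (intro exI[of _ "d - Cn_dist n y z"] conjI ballI impI)
      show "0 < d - Cn_dist n y z" using y by (simp add: T_def)
      fix w assume "w \<in> topspace (Cn n)" "Cn_dist n w y < d - Cn_dist n y z"
      then show "w \<in> T" using tri[of w] by (simp add: T_def)
    qed
  qed
  moreover have "z \<in> T" using assms d(1) by (simp add: T_def)
  ultimately show "eventually P (atin (Cn n) z)"
    using d(2) by (auto simp: eventually_atin T_def)
qed

text \<open>
  Differentiability as an inequality without division. In this form the centre \<open>w = z\<close> need not be
  excluded, which matters for the chain rule: an inner map may take the value \<open>f z\<close> at points
  other than \<open>z\<close>.
\<close>

lemma has_jacobian_iff:
  assumes z: "z \<in> topspace (Cn n)"
  shows "has_jacobian n m f J z \<longleftrightarrow>
    (\<forall>j<m. \<forall>e>0. \<exists>d>0. \<forall>w\<in>topspace (Cn n). Cn_dist n w z < d \<longrightarrow>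
        cmod (lin_err n f J z j w) \<le> e * Cn_dist n w z)"
proof -
  have "((\<lambda>w. lin_err n f J z j w / complex_of_real (Cn_dist n w z)) \<longlongrightarrow> 0) (atin (Cn n) z) \<longleftrightarrow>
    (\<forall>e>0. \<exists>d>0. \<forall>w\<in>topspace (Cn n). Cn_dist n w z < d \<longrightarrow>
        cmod (lin_err n f J z j w) \<le> e * Cn_dist n w z)" (is "?L \<longleftrightarrow> ?R") for j
  proof
    assume L: ?L
    show ?R
    proof (intro allI impI)
      fix e :: real assume "e > 0"
      with L have "eventually (\<lambda>w. cmod (lin_err n f J z j w / of_real (Cn_dist n w z)) < e) (atin (Cn n) z)"
        by (auto simp: tendsto_iff)
      then obtain d where d: "d > 0" "\<And>w. w\<in>topspace (Cn n) \<Longrightarrow> w \<noteq> z \<Longrightarrow> Cn_dist n w z < d \<Longrightarrow>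
           cmod (lin_err n f J z j w / of_real (Cn_dist n w z)) < e"
        unfolding eventually_atin_Cn[OF z] by blast
      have "cmod (lin_err n f J z j w) \<le> e * Cn_dist n w z"
        if w: "w\<in>topspace (Cn n)" "Cn_dist n w z < d" for w
      proof (cases "w = z")
        case True then show ?thesis by (simp add: lin_err_def)
      next
        case False
        then show ?thesis using d(2)[OF w(1) False w(2)] Cn_dist_pos[OF w(1) z False]
          by (simp add: norm_divide field_simps)
      qed
      then show "\<exists>d>0. \<forall>w\<in>topspace (Cn n). Cn_dist n w z < d \<longrightarrow>
        cmod (lin_err n f J z j w) \<le> e * Cn_dist n w z" using d(1) by blast
    qed
  next
    assume R: ?R
    show ?L
      unfolding tendsto_iff
    proof (intro allI impI)
      fix e :: real assume e: "e > 0"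
      then obtain d where d: "d > 0" "\<And>w. w\<in>topspace (Cn n) \<Longrightarrow> Cn_dist n w z < d \<Longrightarrow>
           cmod (lin_err n f J z j w) \<le> e / 2 * Cn_dist n w z"
        using R by (meson half_gt_zero)
      have "dist (lin_err n f J z j w / of_real (Cn_dist n w z)) 0 < e"
        if w: "w\<in>topspace (Cn n)" "w \<noteq> z" "Cn_dist n w z < d" for w
      proof -
        have p: "Cn_dist n w z > 0" using Cn_dist_pos w z by blast
        have "cmod (lin_err n f J z j w) < e * Cn_dist n w z"
          using d(2)[OF w(1,3)] mult_pos_pos[OF e p] by simp
        then show ?thesis using p by (simp add: norm_divide field_simps)
      qed
      then show "eventually (\<lambda>w. dist (lin_err n f J z j w / of_real (Cn_dist n w z)) 0 < e) (atin (Cn n) z)"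
        unfolding eventually_atin_Cn[OF z] using d(1) by blast
    qed
  qed
  then show ?thesis
    unfolding has_jacobian_def lin_err_def Cn_dist_def by simp
qed

text \<open>
  Apply the differentiability estimate with \<open>e = 1\<close>: near \<open>z\<close> the increment of \<open>f\<close> is at most the
  remainder plus the linear part, both proportional to the distance.
\<close>

lemma has_jacobian_lipschitz:
  assumes z: "z \<in> topspace (Cn n)" and f: "has_jacobian n m f J z"
  obtains L d where "L > 0" "d > 0"
    "\<And>w. w \<in> topspace (Cn n) \<Longrightarrow> Cn_dist n w z < d \<Longrightarrow> Cn_dist m (f w) (f z) \<le> L * Cn_dist n w z"
proof -
  have "\<forall>j\<in>{..<m}. \<exists>d>0. \<forall>w\<in>topspace (Cn n). Cn_dist n w z < d \<longrightarrow>
        cmod (lin_err n f J z j w) \<le> 1 * Cn_dist n w z"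
    using f z has_jacobian_iff by (metis lessThan_iff zero_less_one)
  then obtain d where d: "\<And>j. j < m \<Longrightarrow> d j > 0"
    "\<And>j w. j < m \<Longrightarrow> w\<in>topspace (Cn n) \<Longrightarrow> Cn_dist n w z < d j \<Longrightarrow>
        cmod (lin_err n f J z j w) \<le> Cn_dist n w z"
    by (metis lessThan_iff mult_1)
  define D where "D = Min (insert 1 (d ` {..<m}))"
  define L where "L = 1 + (\<Sum>j<m. 1 + (\<Sum>i<n. cmod (J j i)))"
  have "L > 0" unfolding L_def by (intro add_pos_nonneg sum_nonneg add_nonneg_nonneg) auto
  moreover have "D > 0" using d by (auto simp: D_def)
  moreover have "Cn_dist m (f w) (f z) \<le> L * Cn_dist n w z"
    if w: "w \<in> topspace (Cn n)" "Cn_dist n w z < D" for w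
  proof -
    have c: "cmod (f w j - f z j) \<le> (1 + (\<Sum>i<n. cmod (J j i))) * Cn_dist n w z" if j: "j < m" for j
    proof -
      have "D \<le> d j" using j by (auto simp: D_def)
      then have "cmod (lin_err n f J z j w) \<le> Cn_dist n w z" using d(2)[OF j w(1)] w(2) by simp
      moreover have "cmod (\<Sum>i<n. J j i * (w i - z i)) \<le> (\<Sum>i<n. cmod (J j i) * Cn_dist n w z)"
        by (intro sum_norm_le) (simp add: norm_mult mult_left_mono component_le_Cn_dist)
      moreover have "f w j - f z j = lin_err n f J z j w + (\<Sum>i<n. J j i * (w i - z i))"
        by (simp add: lin_err_def)
      ultimately show ?thesis
        using norm_triangle_ineq[of "lin_err n f J z j w" "\<Sum>i<n. J j i * (w i - z i)"]
        by (simp add: distrib_right sum_distrib_right)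
    qed
    have "Cn_dist m (f w) (f z) \<le> (\<Sum>j<m. cmod (f w j - f z j))"
      unfolding Cn_dist_def by (rule L2_set_le_sum) auto
    also have "\<dots> \<le> (\<Sum>j<m. (1 + (\<Sum>i<n. cmod (J j i))) * Cn_dist n w z)"
      using c by (intro sum_mono) auto
    also have "\<dots> = (\<Sum>j<m. 1 + (\<Sum>i<n. cmod (J j i))) * Cn_dist n w z"
      by (simp only: sum_distrib_right)
    also have "\<dots> \<le> L * Cn_dist n w z"
      unfolding L_def by (intro mult_right_mono) (auto simp: Cn_dist_nonneg)
    finally show ?thesis .
  qed
  ultimately show ?thesis using that by blast
qed

text \<open>
  The chain rule. The remainder of the composite is the remainder of \<open>g\<close> at \<open>f w\<close> plus the matrix
  \<open>K\<close> applied to the remainder of \<open>f\<close>. The composite is extended by \<open>undefined\<close> outside \<open>U\<close>, so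
  openness of \<open>U\<close> is what makes it agree with \<open>g \<circ> f\<close> near \<open>z\<close>.
\<close>

lemma has_jacobian_compose:
  assumes U: "openin (Cn n) U" "z \<in> U" and V: "V \<subseteq> topspace (Cn m)" "f \<in> U \<rightarrow> V"
    and f: "has_jacobian n m f J z" and g: "has_jacobian m p g K (f z)"
  shows "has_jacobian n p (compose U g f) (\<lambda>k i. \<Sum>j<m. K k j * J j i) z"
proof -
  have z: "z \<in> topspace (Cn n)" using U openin_subset by blast
  have fz: "f z \<in> topspace (Cn m)" using U V by blast
  obtain L d1 where L: "L > 0" "d1 > 0"
    "\<And>w. w \<in> topspace (Cn n) \<Longrightarrow> Cn_dist n w z < d1 \<Longrightarrow> Cn_dist m (f w) (f z) \<le> L * Cn_dist n w z"
    using has_jacobian_lipschitz[OF z f] by metis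
  obtain d0 where d0: "d0 > 0" "\<And>w. w \<in> topspace (Cn n) \<Longrightarrow> Cn_dist n w z < d0 \<Longrightarrow> w \<in> U"
    using U by (auto simp: openin_Cn_iff)
  show ?thesis
    unfolding has_jacobian_iff[OF z]
  proof (intro allI impI)
    fix k and e :: real assume k: "k < p" and e: "e > 0"
    \<comment> \<open>Each of the two parts of the remainder gets half of \<open>e\<close>: the first is scaled by the
      Lipschitz constant \<open>L\<close> of \<open>f\<close>, the second by the row sum \<open>S\<close> of \<open>K\<close>; the summand 1 makes \<open>S\<close>
      positive.\<close>
    define S where "S = 1 + (\<Sum>j<m. cmod (K k j))"
    have S: "S > 0" unfolding S_def by (intro add_pos_nonneg sum_nonneg) auto
    obtain d2 where d2: "d2 > 0" "\<And>y. y \<in> topspace (Cn m) \<Longrightarrow> Cn_dist m y (f z) < d2 \<Longrightarrow>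
        cmod (lin_err m g K (f z) k y) \<le> e / (2 * L) * Cn_dist m y (f z)"
      using g k e L(1) unfolding has_jacobian_iff[OF fz]
      by (metis divide_pos_pos mult_pos_pos zero_less_numeral)
    have "\<forall>j\<in>{..<m}. \<exists>d>0. \<forall>w\<in>topspace (Cn n). Cn_dist n w z < d \<longrightarrow>
          cmod (lin_err n f J z j w) \<le> e / (2 * S) * Cn_dist n w z"
      using f z has_jacobian_iff e S by (metis lessThan_iff divide_pos_pos mult_pos_pos zero_less_numeral)
    then obtain d where d: "\<And>j. j < m \<Longrightarrow> d j > 0"
      "\<And>j w. j < m \<Longrightarrow> w\<in>topspace (Cn n) \<Longrightarrow> Cn_dist n w z < d j \<Longrightarrow>
          cmod (lin_err n f J z j w) \<le> e / (2 * S) * Cn_dist n w z"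
      by (metis lessThan_iff)
    define D where "D = Min ({d0, d1, d2 / L} \<union> d ` {..<m})"
    have D: "D > 0" "D \<le> d0" "D \<le> d1" "D \<le> d2 / L" "\<And>j. j < m \<Longrightarrow> D \<le> d j"
      using d0(1) L(1,2) d2(1) d(1) unfolding D_def by (simp, (intro Min_le; simp)+)
    have "cmod (lin_err n (compose U g f) (\<lambda>k i. \<Sum>j<m. K k j * J j i) z k w) \<le> e * Cn_dist n w z"
      if w: "w \<in> topspace (Cn n)" "Cn_dist n w z < D" for w
    proof -
      have wU: "w \<in> U" using d0(2) w D(2) by simp
      have lip: "Cn_dist m (f w) (f z) \<le> L * Cn_dist n w z" using L(3) w D(3) by simp
      also have "\<dots> < L * (d2 / L)" using w(2) D(4) L(1) by (intro mult_strict_left_mono) auto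
      also have "\<dots> = d2" using L(1) by simp
      finally have "Cn_dist m (f w) (f z) < d2" .
      then have "cmod (lin_err m g K (f z) k (f w)) \<le> e / (2 * L) * Cn_dist m (f w) (f z)"
        using d2(2) wU V by blast
      also have "\<dots> \<le> e / (2 * L) * (L * Cn_dist n w z)"
        using lip e L(1) by (intro mult_left_mono) auto
      also have "\<dots> = e / 2 * Cn_dist n w z" using L(1) by simp
      finally have 1: "cmod (lin_err m g K (f z) k (f w)) \<le> e / 2 * Cn_dist n w z" .
      have "cmod (\<Sum>j<m. K k j * lin_err n f J z j w) \<le> (\<Sum>j<m. cmod (K k j) * (e / (2 * S) * Cn_dist n w z))"
      proof (intro sum_norm_le)
        fix j assume "j \<in> {..<m}"
        then have "cmod (lin_err n f J z j w) \<le> e / (2 * S) * Cn_dist n w z"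
          using d(2)[of j w] D(5)[of j] w by simp
        then show "cmod (K k j * lin_err n f J z j w) \<le> cmod (K k j) * (e / (2 * S) * Cn_dist n w z)"
          unfolding norm_mult by (intro mult_left_mono) auto
      qed
      also have "\<dots> = (\<Sum>j<m. cmod (K k j)) * (e / (2 * S) * Cn_dist n w z)"
        by (simp only: sum_distrib_right)
      also have "\<dots> \<le> S * (e / (2 * S) * Cn_dist n w z)"
        using e S by (intro mult_right_mono) (auto simp: S_def Cn_dist_nonneg)
      also have "\<dots> = e / 2 * Cn_dist n w z" using S by simp
      finally have 2: "cmod (\<Sum>j<m. K k j * lin_err n f J z j w) \<le> e / 2 * Cn_dist n w z" .
      have "lin_err n (compose U g f) (\<lambda>k i. \<Sum>j<m. K k j * J j i) z k w =
          lin_err m g K (f z) k (f w) + (\<Sum>j<m. K k j * lin_err n f J z j w)"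
      proof -
        have "(\<Sum>i<n. (\<Sum>j<m. K k j * J j i) * (w i - z i)) = (\<Sum>i<n. \<Sum>j<m. K k j * (J j i * (w i - z i)))"
          by (simp add: sum_distrib_right mult.assoc)
        also have "\<dots> = (\<Sum>j<m. \<Sum>i<n. K k j * (J j i * (w i - z i)))" by (rule sum.swap)
        also have "\<dots> = (\<Sum>j<m. K k j * (\<Sum>i<n. J j i * (w i - z i)))"
          by (simp add: sum_distrib_left)
        finally show ?thesis
          using wU U(2) by (simp add: lin_err_def compose_def right_diff_distrib sum_subtractf)
      qed
      then show ?thesis
        using 1 2 norm_triangle_ineq[of "lin_err m g K (f z) k (f w)" "\<Sum>j<m. K k j * lin_err n f J z j w"]
        by simp
    qed
    then show "\<exists>d>0. \<forall>w\<in>topspace (Cn n). Cn_dist n w z < d \<longrightarrow>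
      cmod (lin_err n (compose U g f) (\<lambda>k i. \<Sum>j<m. K k j * J j i) z k w) \<le> e * Cn_dist n w z"
      using D(1) by blast
  qed
qed

lemma has_jacobian_id:
  assumes "openin (Cn n) U" "z \<in> U"
  shows "has_jacobian n n (\<lambda>x\<in>U. x) (\<lambda>j i. if i = j then 1 else 0) z"
proof -
  have z: "z \<in> topspace (Cn n)" using assms openin_subset by blast
  obtain d where d: "d > 0" "\<And>w. w \<in> topspace (Cn n) \<Longrightarrow> Cn_dist n w z < d \<Longrightarrow> w \<in> U"
    using assms by (auto simp: openin_Cn_iff)
  have "lin_err n (\<lambda>x\<in>U. x) (\<lambda>j i. if i = j then 1 else 0) z j w = 0" if "w \<in> U" "j < n" for j w
  proof -
    have "(\<Sum>i<n. (if i = j then 1 else 0) * (w i - z i)) = (\<Sum>i<n. if i = j then w i - z i else 0)"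
      by (rule sum.cong) auto
    then show ?thesis using that assms(2) by (simp add: lin_err_def)
  qed
  then show ?thesis
    unfolding has_jacobian_iff[OF z] using d
    by (metis Cn_dist_nonneg less_imp_le mult_nonneg_nonneg norm_zero)
qed

lemma holomorphic_map_compose:
  assumes "openin (Cn n) U" "V \<subseteq> topspace (Cn m)"
    and f: "holomorphic_map n m U V f" and g: "holomorphic_map m p V W g"
  shows "holomorphic_map n p U W (compose U g f)"
  unfolding holomorphic_map_def
proof (intro conjI ballI)
  show "compose U g f \<in> U \<rightarrow>\<^sub>E W"
    using f g by (auto simp: holomorphic_map_def compose_def PiE_def Pi_def)
  fix z assume z: "z \<in> U"
  then have "f z \<in> V" using f by (auto simp: holomorphic_map_def)
  then obtain J K where "has_jacobian n m f J z" "has_jacobian m p g K (f z)"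
    using f g z unfolding holomorphic_map_def by blast
  then show "\<exists>J. has_jacobian n p (compose U g f) J z"
    using has_jacobian_compose[OF assms(1) z assms(2)] f
    unfolding holomorphic_map_def PiE_def by blast
qed

lemma holomorphic_map_id:
  "openin (Cn n) U \<Longrightarrow> holomorphic_map n n U U (\<lambda>x\<in>U. x)"
  unfolding holomorphic_map_def by (auto intro: has_jacobian_id)

text \<open>
  The three parts of an embedding compose separately; for the immersion part the Jacobian of the
  composite is the product \<open>K J\<close>, and \<open>K J h = 0\<close> forces \<open>J h = 0\<close> and then \<open>h = 0\<close>.
\<close>

lemma holomorphic_embedding_compose:
  assumes U: "openin (Cn n) U" and V: "V \<subseteq> topspace (Cn m)"
    and f: "holomorphic_embedding n m U V f" and g: "holomorphic_embedding m p V W g"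
  shows "holomorphic_embedding n p U W (compose U g f)"
  unfolding holomorphic_embedding_def
proof (intro conjI ballI)
  have fU: "f \<in> U \<rightarrow> V"
    using f by (auto simp: holomorphic_embedding_def holomorphic_map_def PiE_def)
  show "holomorphic_map n p U W (compose U g f)"
    using assms holomorphic_map_compose by (auto simp: holomorphic_embedding_def)
  have "embedding_map (subtopology (Cn n) U) (subtopology (Cn p) W) (g \<circ> f)"
    using f g by (auto simp: holomorphic_embedding_def intro: embedding_map_compose)
  then show "embedding_map (subtopology (Cn n) U) (subtopology (Cn p) W) (compose U g f)"
    by (rule embedding_map_eq) (auto simp: compose_def)
  fix z assume z: "z \<in> U"
  then have "f z \<in> V" using fU by blast
  then obtain K where K: "has_jacobian m p g K (f z)"
      "\<forall>h\<in>topspace (Cn m). (\<forall>j<p. (\<Sum>i<m. K j i * h i) = 0) \<longrightarrow> (\<forall>i<m. h i = 0)"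
    using g unfolding holomorphic_embedding_def by blast
  obtain J where J: "has_jacobian n m f J z"
      "\<forall>h\<in>topspace (Cn n). (\<forall>j<m. (\<Sum>i<n. J j i * h i) = 0) \<longrightarrow> (\<forall>i<n. h i = 0)"
    using f z unfolding holomorphic_embedding_def by blast
  let ?M = "\<lambda>k i. \<Sum>j<m. K k j * J j i"
  have "\<forall>i<n. h i = 0" if h: "h \<in> topspace (Cn n)" "\<forall>k<p. (\<Sum>i<n. ?M k i * h i) = 0" for h
  proof -
    \<comment> \<open>The vector \<open>J h\<close>, restricted so that it is a point of \<open>\<complex>\<^sup>m\<close>.\<close>
    define h' where "h' = (\<lambda>j\<in>{..<m}. \<Sum>i<n. J j i * h i)"
    have "(\<Sum>j<m. K k j * h' j) = (\<Sum>i<n. ?M k i * h i)" for k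
    proof -
      have "(\<Sum>j<m. K k j * h' j) = (\<Sum>j<m. \<Sum>i<n. K k j * J j i * h i)"
        by (simp add: h'_def sum_distrib_left mult.assoc)
      also have "\<dots> = (\<Sum>i<n. \<Sum>j<m. K k j * J j i * h i)" by (rule sum.swap)
      finally show ?thesis by (simp add: sum_distrib_right)
    qed
    moreover have "h' \<in> topspace (Cn m)" by (simp add: h'_def topspace_Cn)
    ultimately have "\<forall>j<m. h' j = 0" using K(2) h(2) by auto
    then show ?thesis using J(2) h(1) by (auto simp: h'_def)
  qed
  then show "\<exists>J. has_jacobian n p (compose U g f) J z \<and>
      (\<forall>h\<in>topspace (Cn n). (\<forall>j<p. (\<Sum>i<n. J j i * h i) = 0) \<longrightarrow> (\<forall>i<n. h i = 0))"
    using has_jacobian_compose[OF U z V fU J(1) K(1)] by blast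
qed

lemma holomorphic_embedding_id:
  assumes U: "openin (Cn n) U"
  shows "holomorphic_embedding n n U U (\<lambda>x\<in>U. x)"
  unfolding holomorphic_embedding_def
proof (intro conjI ballI)
  show "holomorphic_map n n U U (\<lambda>x\<in>U. x)" using U by (rule holomorphic_map_id)
  have "embedding_map X X id" for X :: "cvec topology"
    by (simp add: embedding_map_def)
  then show "embedding_map (subtopology (Cn n) U) (subtopology (Cn n) U) (\<lambda>x\<in>U. x)"
    by (rule embedding_map_eq) auto
  fix z assume z: "z \<in> U"
  let ?I = "\<lambda>j i. if i = j then 1 else 0 :: complex"
  have "(\<Sum>i<n. ?I j i * h i) = h j" if "j < n" for j and h :: cvec
  proof -
    have "(\<Sum>i<n. ?I j i * h i) = (\<Sum>i<n. if i = j then h i else 0)" by (rule sum.cong) auto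
    then show ?thesis using that by simp
  qed
  then show "\<exists>J. has_jacobian n n (\<lambda>x\<in>U. x) J z \<and>
      (\<forall>h\<in>topspace (Cn n). (\<forall>j<n. (\<Sum>i<n. J j i * h i) = 0) \<longrightarrow> (\<forall>i<n. h i = 0))"
    using has_jacobian_id[OF U z] by auto
qed

section \<open>Atlases as categories\<close>

lemma compose_cong:
  "(\<And>x. x \<in> A \<Longrightarrow> g (f x) = g' (f' x)) \<Longrightarrow> compose A g f = compose A g' f'"
  by (auto simp: compose_def)

lemma openin_us_dom:
  "orbifold_atlas A \<Longrightarrow> s \<in> at_charts A \<Longrightarrow> openin (Cn (at_dim A)) (us_dom s)"
  by (auto simp: orbifold_atlas_def uniformizing_system_def)

lemma us_dom_subset:
  "orbifold_atlas A \<Longrightarrow> s \<in> at_charts A \<Longrightarrow> us_dom s \<subseteq> topspace (Cn (at_dim A))"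
  by (simp add: openin_us_dom openin_subset)

lemma us_proj_in_space:
  "orbifold_atlas A \<Longrightarrow> s \<in> at_charts A \<Longrightarrow> x \<in> us_dom s \<Longrightarrow> us_proj s x \<in> topspace (at_space A)"
  by (auto simp: orbifold_atlas_def us_image_def)

lemma holomorphic_map_PiE: "holomorphic_map n m U V f \<Longrightarrow> f \<in> U \<rightarrow>\<^sub>E V"
  by (simp add: holomorphic_map_def)

lemma embeddings_PiE: "e \<in> embeddings n s t \<Longrightarrow> e \<in> us_dom s \<rightarrow>\<^sub>E us_dom t"
  by (auto simp: embeddings_def holomorphic_embedding_def dest: holomorphic_map_PiE)

lemma embeddings_in: "e \<in> embeddings n s t \<Longrightarrow> x \<in> us_dom s \<Longrightarrow> e x \<in> us_dom t"
  using embeddings_PiE by blast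

text \<open>
  The source has to be a chart of the atlas and not just any triple: the chain rule needs its
  domain to be open.
\<close>

lemma embeddings_compose:
  assumes A: "orbifold_atlas A" "s \<in> at_charts A" "t \<in> at_charts A"
    and e: "e \<in> embeddings (at_dim A) s t" and e': "e' \<in> embeddings (at_dim A) t u"
  shows "compose (us_dom s) e' e \<in> embeddings (at_dim A) s u"
proof -
  have "holomorphic_embedding (at_dim A) (at_dim A) (us_dom s) (us_dom u) (compose (us_dom s) e' e)"
    using e e' holomorphic_embedding_compose[OF openin_us_dom us_dom_subset] A
    by (auto simp: embeddings_def)
  then show ?thesis
    using e e' embeddings_in[OF e] by (auto simp: embeddings_def compose_def)
qed

lemma embeddings_id:
  assumes "orbifold_atlas A" "s \<in> at_charts A"
  shows "(\<lambda>x\<in>us_dom s. x) \<in> embeddings (at_dim A) s s"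
  using holomorphic_embedding_id[OF openin_us_dom[OF assms]] by (simp add: embeddings_def)

section \<open>Compatible systems\<close>

lemma
  assumes "compatible_system A B f"
  shows csys_base: "continuous_map (at_space A) (at_space B) (cs_base f)"
    and csys_obj: "s \<in> at_charts A \<Longrightarrow> cs_obj f s \<in> at_charts B"
    and csys_image: "s \<in> at_charts A \<Longrightarrow> cs_base f ` us_image s \<subseteq> us_image (cs_obj f s)"
    and csys_lift: "s \<in> at_charts A \<Longrightarrow>
      holomorphic_map (at_dim A) (at_dim B) (us_dom s) (us_dom (cs_obj f s)) (cs_lift f s)"
    and csys_proj: "s \<in> at_charts A \<Longrightarrow> x \<in> us_dom s \<Longrightarrow>
      us_proj (cs_obj f s) (cs_lift f s x) = cs_base f (us_proj s x)"
  using assms by (simp_all add: compatible_system_def is_functor_def atlas_cat_def)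

lemma csys_base_in:
  "compatible_system A B f \<Longrightarrow> p \<in> topspace (at_space A) \<Longrightarrow> cs_base f p \<in> topspace (at_space B)"
  using csys_base continuous_map_funspace by blast

lemma csys_lift_in:
  "compatible_system A B f \<Longrightarrow> s \<in> at_charts A \<Longrightarrow> x \<in> us_dom s \<Longrightarrow> cs_lift f s x \<in> us_dom (cs_obj f s)"
  using csys_lift holomorphic_map_PiE by blast

lemma
  assumes "compatible_system A B f" "s \<in> at_charts A" "t \<in> at_charts A" "e \<in> embeddings (at_dim A) s t"
  shows csys_arr: "cs_arr f s t e \<in> embeddings (at_dim B) (cs_obj f s) (cs_obj f t)"
    and csys_lift_natural: "x \<in> us_dom s \<Longrightarrow> cs_lift f t (e x) = cs_arr f s t e (cs_lift f s x)"
proof -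
  show "cs_arr f s t e \<in> embeddings (at_dim B) (cs_obj f s) (cs_obj f t)"
    using assms by (simp add: compatible_system_def is_functor_def atlas_cat_def)
  assume x: "x \<in> us_dom s"
  have "compose (us_dom s) (cs_lift f t) e = compose (us_dom s) (cs_arr f s t e) (cs_lift f s)"
    using assms by (simp add: compatible_system_def)
  from fun_cong[OF this, of x] show "cs_lift f t (e x) = cs_arr f s t e (cs_lift f s x)"
    using x by (simp add: compose_eq)
qed

lemma csys_arr_id:
  assumes "compatible_system A B f" "s \<in> at_charts A"
  shows "cs_arr f s s (\<lambda>x\<in>us_dom s. x) = (\<lambda>x\<in>us_dom (cs_obj f s). x)"
  using assms by (simp add: compatible_system_def is_functor_def atlas_cat_def)

lemma csys_arr_compose:
  assumes "compatible_system A B f" "s \<in> at_charts A" "t \<in> at_charts A" "u \<in> at_charts A"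
    and "e \<in> embeddings (at_dim A) s t" "e' \<in> embeddings (at_dim A) t u"
  shows "cs_arr f s u (compose (us_dom s) e' e) =
    compose (us_dom (cs_obj f s)) (cs_arr f t u e') (cs_arr f s t e)"
  using assms by (simp add: compatible_system_def is_functor_def atlas_cat_def)

text \<open>
  A compatible system is determined by its values on charts, embeddings and points, because all
  its components are extensional. This reduces the unit and associativity laws for \<open>cs_comp\<close> to
  evaluation.
\<close>

lemma csys_eqI:
  assumes f: "compatible_system A B f" and g: "compatible_system A B g"
    and "\<And>p. p \<in> topspace (at_space A) \<Longrightarrow> cs_base f p = cs_base g p"
    and obj: "\<And>s. s \<in> at_charts A \<Longrightarrow> cs_obj f s = cs_obj g s"
    and "\<And>s t e. s \<in> at_charts A \<Longrightarrow> t \<in> at_charts A \<Longrightarrow> e \<in> embeddings (at_dim A) s t \<Longrightarrow>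
      cs_arr f s t e = cs_arr g s t e"
    and lift: "\<And>s x. s \<in> at_charts A \<Longrightarrow> x \<in> us_dom s \<Longrightarrow> cs_lift f s x = cs_lift g s x"
  shows "f = g"
proof (rule csys.equality)
  have "cs_base f \<in> extensional (topspace (at_space A))" "cs_base g \<in> extensional (topspace (at_space A))"
    using f g by (auto simp: compatible_system_def)
  then show "cs_base f = cs_base g"
    using assms(3) by (rule extensionalityI)
  have "cs_obj f \<in> extensional (at_charts A)" "cs_obj g \<in> extensional (at_charts A)"
    using f g by (auto simp: compatible_system_def)
  then show "cs_obj f = cs_obj g"
    using obj by (rule extensionalityI)
  have "cs_arr f s t e = cs_arr g s t e" for s t e
    using assms unfolding compatible_system_def by metis
  then show "cs_arr f = cs_arr g" by blast
  have "cs_lift f s = cs_lift g s" if s: "s \<in> at_charts A" for s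
    using lift[OF s] holomorphic_map_PiE[OF csys_lift[OF f s]] holomorphic_map_PiE[OF csys_lift[OF g s]]
    unfolding obj[OF s] by (intro PiE_ext) auto
  moreover have "cs_lift f \<in> extensional (at_charts A)" "cs_lift g \<in> extensional (at_charts A)"
    using f g by (auto simp: compatible_system_def)
  ultimately show "cs_lift f = cs_lift g"
    by (metis extensionalityI)
qed simp

lemma cs_comp_simps:
  "p \<in> topspace (at_space A) \<Longrightarrow> cs_base (cs_comp A g f) p = cs_base g (cs_base f p)"
  "s \<in> at_charts A \<Longrightarrow> cs_obj (cs_comp A g f) s = cs_obj g (cs_obj f s)"
  "s \<in> at_charts A \<Longrightarrow> t \<in> at_charts A \<Longrightarrow> e \<in> embeddings (at_dim A) s t \<Longrightarrow>
     cs_arr (cs_comp A g f) s t e = cs_arr g (cs_obj f s) (cs_obj f t) (cs_arr f s t e)"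
  "s \<in> at_charts A \<Longrightarrow> x \<in> us_dom s \<Longrightarrow>
     cs_lift (cs_comp A g f) s x = cs_lift g (cs_obj f s) (cs_lift f s x)"
  by (simp_all add: cs_comp_def compose_eq)

lemma cs_id_simps:
  "p \<in> topspace (at_space A) \<Longrightarrow> cs_base (cs_id A) p = p"
  "s \<in> at_charts A \<Longrightarrow> cs_obj (cs_id A) s = s"
  "s \<in> at_charts A \<Longrightarrow> t \<in> at_charts A \<Longrightarrow> e \<in> embeddings (at_dim A) s t \<Longrightarrow>
     cs_arr (cs_id A) s t e = e"
  "s \<in> at_charts A \<Longrightarrow> x \<in> us_dom s \<Longrightarrow> cs_lift (cs_id A) s x = x"
  by (simp_all add: cs_id_def)

lemma compatible_system_id:
  assumes A: "orbifold_atlas A"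
  shows "compatible_system A A (cs_id A)"
  unfolding compatible_system_def
proof (intro conjI ballI)
  have "continuous_map (at_space A) (at_space A) id" by simp
  then show "continuous_map (at_space A) (at_space A) (cs_base (cs_id A))"
    by (rule continuous_map_eq) (simp add: cs_id_def)
  show "is_functor (atlas_cat A) (atlas_cat A) (cs_obj (cs_id A)) (cs_arr (cs_id A))"
    using A by (auto simp: is_functor_def atlas_cat_def cs_id_simps embeddings_id embeddings_compose)
  show "cs_base (cs_id A) ` us_image s \<subseteq> us_image (cs_obj (cs_id A) s)" if "s \<in> at_charts A" for s
    using that us_proj_in_space[OF A] by (auto simp: cs_id_simps us_image_def)
  show "holomorphic_map (at_dim A) (at_dim A) (us_dom s) (us_dom (cs_obj (cs_id A) s)) (cs_lift (cs_id A) s)"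
    if "s \<in> at_charts A" for s
    using that A by (simp add: cs_id_def holomorphic_map_id openin_us_dom)
  show "us_proj (cs_obj (cs_id A) s) (cs_lift (cs_id A) s x) = cs_base (cs_id A) (us_proj s x)"
    if "s \<in> at_charts A" "x \<in> us_dom s" for s x
    using that A by (simp add: cs_id_simps us_proj_in_space)
  show "compose (us_dom s) (cs_lift (cs_id A) t) e = compose (us_dom s) (cs_arr (cs_id A) s t e) (cs_lift (cs_id A) s)"
    if "s \<in> at_charts A" "t \<in> at_charts A" "e \<in> embeddings (at_dim A) s t" for s t e
    using that by (intro compose_cong) (simp add: cs_id_simps embeddings_in)
qed (auto simp: cs_id_def)

text \<open>
  Functors compose and holomorphic maps compose. The liftings commute with the images of an
  embedding by pasting the commuting squares of \<open>f\<close> and \<open>g\<close>.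
\<close>

lemma compatible_system_comp:
  assumes A: "orbifold_atlas A" and B: "orbifold_atlas B"
    and f: "compatible_system A B f" and g: "compatible_system B C g"
  shows "compatible_system A C (cs_comp A g f)"
  unfolding compatible_system_def
proof (intro conjI ballI)
  note rules = csys_obj[OF f] csys_obj[OF g] csys_arr[OF f] csys_arr[OF g] cs_comp_simps
  have "continuous_map (at_space A) (at_space C) (cs_base g \<circ> cs_base f)"
    using csys_base[OF f] csys_base[OF g] by (rule continuous_map_compose)
  then show "continuous_map (at_space A) (at_space C) (cs_base (cs_comp A g f))"
    by (rule continuous_map_eq) (simp add: cs_comp_simps)
  show "is_functor (atlas_cat A) (atlas_cat C) (cs_obj (cs_comp A g f)) (cs_arr (cs_comp A g f))"
    using A by (simp add: is_functor_def atlas_cat_def rules embeddings_id embeddings_compose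
        csys_arr_id[OF f] csys_arr_id[OF g] csys_arr_compose[OF f] csys_arr_compose[OF g])
  show "cs_base (cs_comp A g f) ` us_image s \<subseteq> us_image (cs_obj (cs_comp A g f) s)"
    if s: "s \<in> at_charts A" for s
  proof -
    have "us_image s \<subseteq> topspace (at_space A)"
      using us_proj_in_space[OF A s] by (auto simp: us_image_def)
    then have "cs_base (cs_comp A g f) ` us_image s = cs_base g ` (cs_base f ` us_image s)"
      by (force simp: cs_comp_simps image_image intro!: image_cong)
    also have "\<dots> \<subseteq> us_image (cs_obj g (cs_obj f s))"
      using csys_image[OF f s] csys_image[OF g csys_obj[OF f s]] by blast
    finally show ?thesis using s by (simp add: rules)
  qed
  show "holomorphic_map (at_dim A) (at_dim C) (us_dom s) (us_dom (cs_obj (cs_comp A g f) s))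
      (cs_lift (cs_comp A g f) s)" if s: "s \<in> at_charts A" for s
    using holomorphic_map_compose[OF openin_us_dom[OF A s] us_dom_subset[OF B csys_obj[OF f s]]
        csys_lift[OF f s] csys_lift[OF g csys_obj[OF f s]]] s
    by (simp add: cs_comp_def compose_eq)
  show "us_proj (cs_obj (cs_comp A g f) s) (cs_lift (cs_comp A g f) s x) = cs_base (cs_comp A g f) (us_proj s x)"
    if "s \<in> at_charts A" "x \<in> us_dom s" for s x
    using that A by (simp add: rules csys_proj[OF f] csys_proj[OF g] csys_lift_in[OF f] us_proj_in_space)
  show "compose (us_dom s) (cs_lift (cs_comp A g f) t) e =
      compose (us_dom s) (cs_arr (cs_comp A g f) s t e) (cs_lift (cs_comp A g f) s)"
    if st: "s \<in> at_charts A" "t \<in> at_charts A" "e \<in> embeddings (at_dim A) s t" for s t e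
    using st by (intro compose_cong)
      (simp add: rules embeddings_in csys_lift_natural[OF f] csys_lift_natural[OF g] csys_lift_in[OF f])
qed (auto simp: cs_comp_def)

lemma cs_comp_assoc:
  assumes "orbifold_atlas A" "orbifold_atlas B" "orbifold_atlas C"
    and f: "compatible_system A B f" and g: "compatible_system B C g" and h: "compatible_system C D h"
  shows "cs_comp A h (cs_comp A g f) = cs_comp A (cs_comp B h g) f"
proof (rule csys_eqI)
  show "compatible_system A D (cs_comp A h (cs_comp A g f))"
    "compatible_system A D (cs_comp A (cs_comp B h g) f)"
    using assms by (auto intro: compatible_system_comp)
qed (simp_all add: cs_comp_simps csys_base_in[OF f] csys_obj[OF f] csys_arr[OF f] csys_lift_in[OF f])

lemma cs_comp_id_right:
  assumes "orbifold_atlas A" and f: "compatible_system A B f"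
  shows "cs_comp A f (cs_id A) = f"
proof (rule csys_eqI[OF _ f])
  show "compatible_system A B (cs_comp A f (cs_id A))"
    using assms compatible_system_comp compatible_system_id by blast
qed (simp_all add: cs_comp_simps cs_id_simps)

lemma cs_comp_id_left:
  assumes "orbifold_atlas A" "orbifold_atlas B" and f: "compatible_system A B f"
  shows "cs_comp A (cs_id B) f = f"
proof (rule csys_eqI[OF _ f])
  show "compatible_system A B (cs_comp A (cs_id B) f)"
    using assms compatible_system_comp compatible_system_id by blast
qed (simp_all add: cs_comp_simps cs_id_simps csys_base_in[OF f] csys_obj[OF f] csys_arr[OF f] csys_lift_in[OF f])

section \<open>Natural transformations\<close>

lemma
  assumes "natural_transformation A B f1 f2 \<delta>"
  shows nt_base: "cs_base f1 = cs_base f2"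
    and nt_extensional: "\<delta> \<in> extensional (at_charts A)"
    and nt_embedding: "s \<in> at_charts A \<Longrightarrow> \<delta> s \<in> embeddings (at_dim B) (cs_obj f1 s) (cs_obj f2 s)"
  using assms by (simp_all add: natural_transformation_def)

lemma nt_lift:
  assumes "natural_transformation A B f1 f2 \<delta>" "s \<in> at_charts A" "x \<in> us_dom s"
  shows "cs_lift f2 s x = \<delta> s (cs_lift f1 s x)"
  using assms by (simp add: natural_transformation_def compose_eq)

lemma nt_natural:
  assumes "natural_transformation A B f1 f2 \<delta>" "s \<in> at_charts A" "t \<in> at_charts A"
    and "e \<in> embeddings (at_dim A) s t" and y: "y \<in> us_dom (cs_obj f1 s)"
  shows "cs_arr f2 s t e (\<delta> s y) = \<delta> t (cs_arr f1 s t e y)"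
proof -
  have "compose (us_dom (cs_obj f1 s)) (cs_arr f2 s t e) (\<delta> s) =
        compose (us_dom (cs_obj f1 s)) (\<delta> t) (cs_arr f1 s t e)"
    using assms by (simp add: natural_transformation_def)
  from fun_cong[OF this, of y] show ?thesis using y by (simp add: compose_eq)
qed

text \<open>
  The defining equations of a natural transformation may be checked pointwise; for the one on
  liftings this uses that the liftings of \<open>f2\<close> are extensional.
\<close>

lemma natural_transformationI:
  assumes "compatible_system A B f2" "cs_base f1 = cs_base f2" "\<delta> \<in> extensional (at_charts A)"
    and "\<And>s. s \<in> at_charts A \<Longrightarrow> \<delta> s \<in> embeddings (at_dim B) (cs_obj f1 s) (cs_obj f2 s)"
    and lift: "\<And>s x. s \<in> at_charts A \<Longrightarrow> x \<in> us_dom s \<Longrightarrow> cs_lift f2 s x = \<delta> s (cs_lift f1 s x)"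
    and "\<And>s t e y. s \<in> at_charts A \<Longrightarrow> t \<in> at_charts A \<Longrightarrow> e \<in> embeddings (at_dim A) s t \<Longrightarrow>
      y \<in> us_dom (cs_obj f1 s) \<Longrightarrow> cs_arr f2 s t e (\<delta> s y) = \<delta> t (cs_arr f1 s t e y)"
  shows "natural_transformation A B f1 f2 \<delta>"
proof -
  have "cs_lift f2 s = compose (us_dom s) (\<delta> s) (cs_lift f1 s)" if s: "s \<in> at_charts A" for s
  proof (rule extensionalityI)
    show "cs_lift f2 s \<in> extensional (us_dom s)"
      using holomorphic_map_PiE[OF csys_lift[OF assms(1) s]] by (simp add: PiE_def)
  qed (use s lift in \<open>auto simp: compose_eq\<close>)
  then show ?thesis
    using assms unfolding natural_transformation_def by (auto intro!: compose_cong)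
qed

lemma nt_eqI:
  assumes \<delta>: "natural_transformation A B f1 f2 \<delta>" and \<sigma>: "natural_transformation A B f1 f2 \<sigma>"
    and eq: "\<And>s y. s \<in> at_charts A \<Longrightarrow> y \<in> us_dom (cs_obj f1 s) \<Longrightarrow> \<delta> s y = \<sigma> s y"
  shows "\<delta> = \<sigma>"
proof (rule extensionalityI)
  show "\<delta> s = \<sigma> s" if s: "s \<in> at_charts A" for s
    using embeddings_PiE[OF nt_embedding[OF \<delta> s]] embeddings_PiE[OF nt_embedding[OF \<sigma> s]] eq[OF s]
    by (rule PiE_ext)
qed (use \<delta> \<sigma> in \<open>auto intro: nt_extensional\<close>)

lemma nt_vcomp_apply:
  "s \<in> at_charts A \<Longrightarrow> y \<in> us_dom (cs_obj f1 s) \<Longrightarrow> nt_vcomp A f1 \<sigma> \<delta> s y = \<sigma> s (\<delta> s y)"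
  by (simp add: nt_vcomp_def compose_eq)

lemma nt_id_apply:
  "s \<in> at_charts A \<Longrightarrow> y \<in> us_dom (cs_obj f s) \<Longrightarrow> nt_id A f s y = y"
  by (simp add: nt_id_def)

lemma nt_hcomp_apply:
  "s \<in> at_charts A \<Longrightarrow> y \<in> us_dom (cs_obj g1 (cs_obj f1 s)) \<Longrightarrow>
    nt_hcomp A g1 f1 f2 \<eta> \<delta> s y = \<eta> (cs_obj f2 s) (cs_arr g1 (cs_obj f1 s) (cs_obj f2 s) (\<delta> s) y)"
  by (simp add: nt_hcomp_def compose_eq)

lemma natural_transformation_id:
  assumes B: "orbifold_atlas B" and f: "compatible_system A B f"
  shows "natural_transformation A B f f (nt_id A f)"
proof (rule natural_transformationI[OF f])
  show "nt_id A f s \<in> embeddings (at_dim B) (cs_obj f s) (cs_obj f s)" if "s \<in> at_charts A" for s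
    using that by (simp add: nt_id_def embeddings_id[OF B] csys_obj[OF f])
qed (auto simp: nt_id_apply csys_lift_in[OF f] embeddings_in[OF csys_arr[OF f]], simp add: nt_id_def)

lemma natural_transformation_vcomp:
  assumes B: "orbifold_atlas B" and f1: "compatible_system A B f1"
    and f2: "compatible_system A B f2" and f3: "compatible_system A B f3"
    and \<delta>: "natural_transformation A B f1 f2 \<delta>" and \<sigma>: "natural_transformation A B f2 f3 \<sigma>"
  shows "natural_transformation A B f1 f3 (nt_vcomp A f1 \<sigma> \<delta>)"
proof (rule natural_transformationI[OF f3])
  show "cs_base f1 = cs_base f3" using nt_base[OF \<delta>] nt_base[OF \<sigma>] by simp
  show "nt_vcomp A f1 \<sigma> \<delta> \<in> extensional (at_charts A)" by (simp add: nt_vcomp_def)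
  fix s assume s: "s \<in> at_charts A"
  show "nt_vcomp A f1 \<sigma> \<delta> s \<in> embeddings (at_dim B) (cs_obj f1 s) (cs_obj f3 s)"
    using s embeddings_compose[OF B csys_obj[OF f1 s] csys_obj[OF f2 s] nt_embedding[OF \<delta> s] nt_embedding[OF \<sigma> s]]
    by (simp add: nt_vcomp_def)
  show "cs_lift f3 s x = nt_vcomp A f1 \<sigma> \<delta> s (cs_lift f1 s x)" if "x \<in> us_dom s" for x
    using that s by (simp add: nt_vcomp_apply csys_lift_in[OF f1] nt_lift[OF \<delta>] nt_lift[OF \<sigma>])
  fix t e y assume t: "t \<in> at_charts A" and e: "e \<in> embeddings (at_dim A) s t"
    and y: "y \<in> us_dom (cs_obj f1 s)"
  then show "cs_arr f3 s t e (nt_vcomp A f1 \<sigma> \<delta> s y) = nt_vcomp A f1 \<sigma> \<delta> t (cs_arr f1 s t e y)"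
    using s by (simp add: nt_vcomp_apply embeddings_in[OF csys_arr[OF f1]] embeddings_in[OF nt_embedding[OF \<delta>]]
        nt_natural[OF \<delta>] nt_natural[OF \<sigma>])
qed

text \<open>
  The naturality square of the horizontal composite at an embedding \<open>e\<close> is pasted from two squares:
  that of \<open>\<eta>\<close> at \<open>f\<^sub>2 e\<close>, and the image under \<open>g\<^sub>1\<close> of that of \<open>\<delta>\<close> at \<open>e\<close>. The condition on
  liftings is proved in the same way: the lifting condition of \<open>\<eta>\<close> at \<open>f\<^sub>2 s\<close> is combined with the
  compatibility of the liftings of \<open>g\<^sub>1\<close> with the embedding given by \<open>\<delta>\<close> at \<open>s\<close>.
\<close>

lemma natural_transformation_hcomp:
  assumes A: "orbifold_atlas A" and B: "orbifold_atlas B" and C: "orbifold_atlas C"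
    and f1: "compatible_system A B f1" and f2: "compatible_system A B f2"
    and g1: "compatible_system B C g1" and g2: "compatible_system B C g2"
    and \<delta>: "natural_transformation A B f1 f2 \<delta>" and \<eta>: "natural_transformation B C g1 g2 \<eta>"
  shows "natural_transformation A C (cs_comp A g1 f1) (cs_comp A g2 f2) (nt_hcomp A g1 f1 f2 \<eta> \<delta>)"
proof (rule natural_transformationI)
  note obj = csys_obj[OF f1] csys_obj[OF f2] csys_obj[OF g1] csys_obj[OF g2]
  show "compatible_system A C (cs_comp A g2 f2)"
    using A B f2 g2 by (rule compatible_system_comp)
  show "cs_base (cs_comp A g1 f1) = cs_base (cs_comp A g2 f2)"
    using nt_base[OF \<delta>] nt_base[OF \<eta>] by (simp add: cs_comp_def)
  show "nt_hcomp A g1 f1 f2 \<eta> \<delta> \<in> extensional (at_charts A)" by (simp add: nt_hcomp_def)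
  fix s assume s: "s \<in> at_charts A"
  note ds = nt_embedding[OF \<delta> s]
  show "nt_hcomp A g1 f1 f2 \<eta> \<delta> s \<in>
      embeddings (at_dim C) (cs_obj (cs_comp A g1 f1) s) (cs_obj (cs_comp A g2 f2) s)"
    using s embeddings_compose[OF C _ _ csys_arr[OF g1 _ _ ds] nt_embedding[OF \<eta>]]
    by (simp add: nt_hcomp_def cs_comp_simps obj)
  show "cs_lift (cs_comp A g2 f2) s x = nt_hcomp A g1 f1 f2 \<eta> \<delta> s (cs_lift (cs_comp A g1 f1) s x)"
    if x: "x \<in> us_dom s" for x
    using s x ds
    by (simp add: cs_comp_simps nt_hcomp_apply obj csys_lift_in[OF f1] csys_lift_in[OF g1] nt_lift[OF \<delta>]
        nt_lift[OF \<eta>] embeddings_in[OF ds] csys_lift_natural[OF g1 _ _ ds, symmetric])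
  fix t e y assume t: "t \<in> at_charts A" and e: "e \<in> embeddings (at_dim A) s t"
    and y: "y \<in> us_dom (cs_obj (cs_comp A g1 f1) s)"
  let ?s1 = "cs_obj f1 s" and ?s2 = "cs_obj f2 s" and ?t1 = "cs_obj f1 t" and ?t2 = "cs_obj f2 t"
  note dt = nt_embedding[OF \<delta> t]
  note e1 = csys_arr[OF f1 s t e] and e2 = csys_arr[OF f2 s t e]
  have y': "y \<in> us_dom (cs_obj g1 ?s1)" using y s by (simp add: cs_comp_simps)
  have sq: "compose (us_dom ?s1) (cs_arr f2 s t e) (\<delta> s) = compose (us_dom ?s1) (\<delta> t) (cs_arr f1 s t e)"
    using s t e by (intro compose_cong) (simp add: nt_natural[OF \<delta>])
  have "cs_arr (cs_comp A g2 f2) s t e (nt_hcomp A g1 f1 f2 \<eta> \<delta> s y) =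
      cs_arr g2 ?s2 ?t2 (cs_arr f2 s t e) (\<eta> ?s2 (cs_arr g1 ?s1 ?s2 (\<delta> s) y))"
    using s t e y' by (simp add: cs_comp_simps nt_hcomp_apply)
  also have "\<dots> = \<eta> ?t2 (cs_arr g1 ?s2 ?t2 (cs_arr f2 s t e) (cs_arr g1 ?s1 ?s2 (\<delta> s) y))"
    using s t e2 y' by (simp add: nt_natural[OF \<eta>] obj embeddings_in[OF csys_arr[OF g1 _ _ ds]])
  also have "\<dots> = \<eta> ?t2 (cs_arr g1 ?s1 ?t2 (compose (us_dom ?s1) (cs_arr f2 s t e) (\<delta> s)) y)"
    using s t y' by (simp add: csys_arr_compose[OF g1 _ _ _ ds e2] obj compose_eq)
  also have "\<dots> = \<eta> ?t2 (cs_arr g1 ?t1 ?t2 (\<delta> t) (cs_arr g1 ?s1 ?t1 (cs_arr f1 s t e) y))"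
    using s t y' by (simp add: sq csys_arr_compose[OF g1 _ _ _ e1 dt] obj compose_eq)
  also have "\<dots> = nt_hcomp A g1 f1 f2 \<eta> \<delta> t (cs_arr (cs_comp A g1 f1) s t e y)"
    using s t e y' by (simp add: cs_comp_simps nt_hcomp_apply obj embeddings_in[OF csys_arr[OF g1 _ _ e1]])
  finally show "cs_arr (cs_comp A g2 f2) s t e (nt_hcomp A g1 f1 f2 \<eta> \<delta> s y) =
      nt_hcomp A g1 f1 f2 \<eta> \<delta> t (cs_arr (cs_comp A g1 f1) s t e y)" .
qed

lemma nt_hcomp_id:
  assumes f: "compatible_system A B f" and g: "compatible_system B C g"
  shows "nt_hcomp A g f f (nt_id B g) (nt_id A f) = nt_id A (cs_comp A g f)"
  unfolding nt_hcomp_def nt_id_def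
  by (rule restrict_ext)
    (auto simp: csys_obj[OF f] csys_arr_id[OF g] cs_comp_simps compose_def)

text \<open>
  The interchange law. By functoriality of \<open>g\<^sub>1\<close>, at a chart \<open>s\<close> both sides are composites of four
  embeddings that start with \<open>g\<^sub>1\<close> of \<open>\<delta>\<close> and end with \<open>\<eta>'\<close> at \<open>f\<^sub>3 s\<close>; the middle parts are the
  two ways around the naturality square of \<open>\<eta>\<close> at the embedding given by \<open>\<delta>'\<close> at \<open>s\<close>.
\<close>

lemma nt_interchange:
  assumes f1: "compatible_system A B f1" and f2: "compatible_system A B f2" and f3: "compatible_system A B f3"
    and g1: "compatible_system B C g1"
    and \<delta>: "natural_transformation A B f1 f2 \<delta>" and \<delta>': "natural_transformation A B f2 f3 \<delta>'"
    and \<eta>: "natural_transformation B C g1 g2 \<eta>"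
  shows "nt_hcomp A g1 f1 f3 (nt_vcomp B g1 \<eta>' \<eta>) (nt_vcomp A f1 \<delta>' \<delta>) =
    nt_vcomp A (cs_comp A g1 f1) (nt_hcomp A g2 f2 f3 \<eta>' \<delta>') (nt_hcomp A g1 f1 f2 \<eta> \<delta>)"
    (is "?L = ?R")
proof -
  note obj = csys_obj[OF f1] csys_obj[OF f2] csys_obj[OF f3] csys_obj[OF g1]
  have "?L s = ?R s" if s: "s \<in> at_charts A" for s
  proof -
    let ?s1 = "cs_obj f1 s" and ?s2 = "cs_obj f2 s" and ?s3 = "cs_obj f3 s"
    note d = nt_embedding[OF \<delta> s] and d' = nt_embedding[OF \<delta>' s]
    have "?L s = compose (us_dom (cs_obj g1 ?s1)) (nt_vcomp B g1 \<eta>' \<eta> ?s3)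
        (compose (us_dom (cs_obj g1 ?s1)) (cs_arr g1 ?s2 ?s3 (\<delta>' s)) (cs_arr g1 ?s1 ?s2 (\<delta> s)))"
      using s by (simp add: nt_hcomp_def nt_vcomp_def[of A] csys_arr_compose[OF g1 _ _ _ d d'] obj)
    also have "\<dots> = ?R s"
      using s unfolding nt_vcomp_def[of A]
      by (simp add: cs_comp_simps, intro compose_cong)
        (simp add: compose_eq nt_hcomp_apply obj nt_vcomp_apply embeddings_in[OF csys_arr[OF g1 _ _ d]]
          embeddings_in[OF csys_arr[OF g1 _ _ d']] embeddings_in[OF nt_embedding[OF \<eta>]] nt_natural[OF \<eta> _ _ d'])
    finally show ?thesis .
  qed
  then show ?thesis
    by (intro extensionalityI[of _ "at_charts A"]) (auto simp: nt_hcomp_def nt_vcomp_def)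
qed

text \<open>
  At a chart \<open>s\<close> the two sides differ only in whether \<open>h\<^sub>1\<close> is applied to the composite of \<open>\<eta>\<close> at
  \<open>f\<^sub>2 s\<close> with \<open>g\<^sub>1\<close> of \<open>\<delta>\<close>, or to the two factors; they agree since \<open>h\<^sub>1\<close> is a functor.
\<close>

lemma nt_hcomp_assoc:
  assumes f1: "compatible_system A B f1" and f2: "compatible_system A B f2"
    and g1: "compatible_system B C g1" and g2: "compatible_system B C g2" and h1: "compatible_system C D h1"
    and \<delta>: "natural_transformation A B f1 f2 \<delta>" and \<eta>: "natural_transformation B C g1 g2 \<eta>"
  shows "nt_hcomp A h1 (cs_comp A g1 f1) (cs_comp A g2 f2) \<zeta> (nt_hcomp A g1 f1 f2 \<eta> \<delta>) =
    nt_hcomp A (cs_comp B h1 g1) f1 f2 (nt_hcomp B h1 g1 g2 \<zeta> \<eta>) \<delta>"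
  (is "?L = ?R")
proof -
  note obj = csys_obj[OF f1] csys_obj[OF f2] csys_obj[OF g1] csys_obj[OF g2]
  have "?L s = ?R s" if s: "s \<in> at_charts A" for s
  proof -
    note d = nt_embedding[OF \<delta> s]
    note gd = csys_arr[OF g1 csys_obj[OF f1 s] csys_obj[OF f2 s] d]
    note h = nt_embedding[OF \<eta> csys_obj[OF f2 s]]
    note hgd = csys_arr[OF h1 csys_obj[OF g1 csys_obj[OF f1 s]] csys_obj[OF g1 csys_obj[OF f2 s]] gd]
    show ?thesis
      using s d unfolding nt_hcomp_def[of A]
      by (simp add: cs_comp_simps obj csys_arr_compose[OF h1 _ _ _ gd h], intro compose_cong)
        (simp add: compose_eq nt_hcomp_apply obj embeddings_in[OF hgd])
  qed
  then show ?thesis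
    by (intro extensionalityI[of _ "at_charts A"]) (auto simp: nt_hcomp_def)
qed

lemma nt_hcomp_id_right:
  assumes f1: "compatible_system A B f1" and \<delta>: "natural_transformation A B f1 f2 \<delta>"
  shows "nt_hcomp A f1 (cs_id A) (cs_id A) \<delta> (nt_id A (cs_id A)) = \<delta>"
proof (rule extensionalityI)
  fix s assume s: "s \<in> at_charts A"
  show "nt_hcomp A f1 (cs_id A) (cs_id A) \<delta> (nt_id A (cs_id A)) s = \<delta> s"
    using s embeddings_PiE[OF nt_embedding[OF \<delta> s]]
      compose_Id[of "\<delta> s" "us_dom (cs_obj f1 s)" "us_dom (cs_obj f2 s)"]
    by (simp add: nt_hcomp_def nt_id_def cs_id_simps csys_arr_id[OF f1] PiE_def)
qed (auto simp: nt_hcomp_def nt_extensional[OF \<delta>])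

lemma nt_hcomp_id_left:
  assumes f1: "compatible_system A B f1" and f2: "compatible_system A B f2"
    and \<delta>: "natural_transformation A B f1 f2 \<delta>"
  shows "nt_hcomp A (cs_id B) f1 f2 (nt_id B (cs_id B)) \<delta> = \<delta>"
proof (rule extensionalityI)
  fix s assume s: "s \<in> at_charts A"
  show "nt_hcomp A (cs_id B) f1 f2 (nt_id B (cs_id B)) \<delta> s = \<delta> s"
    using s nt_embedding[OF \<delta> s] embeddings_PiE[OF nt_embedding[OF \<delta> s]]
    by (simp add: nt_hcomp_def nt_id_def cs_id_simps csys_obj[OF f1] csys_obj[OF f2] Id_compose PiE_def)
qed (auto simp: nt_hcomp_def nt_extensional[OF \<delta>])

section \<open>The 2-category\<close>

lemma is_category_hom:
  assumes B: "orbifold_atlas B"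
  shows "is_category (t_hom Pre_Orb A B)"
proof -
  have unit: "nt_vcomp A f1 \<delta> (nt_id A f1) = \<delta>" "nt_vcomp A f1 (nt_id A f2) \<delta> = \<delta>"
    if f: "compatible_system A B f1" "compatible_system A B f2" and \<delta>: "natural_transformation A B f1 f2 \<delta>"
    for f1 f2 \<delta>
  proof -
    note id = natural_transformation_id[OF B]
    show "nt_vcomp A f1 \<delta> (nt_id A f1) = \<delta>"
      using natural_transformation_vcomp[OF B f(1) f id[OF f(1)] \<delta>] \<delta>
      by (rule nt_eqI) (simp add: nt_vcomp_apply nt_id_apply)
    show "nt_vcomp A f1 (nt_id A f2) \<delta> = \<delta>"
      using natural_transformation_vcomp[OF B f f(2) \<delta> id[OF f(2)]] \<delta>
      by (rule nt_eqI) (simp add: nt_vcomp_apply nt_id_apply embeddings_in[OF nt_embedding[OF \<delta>]])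
  qed
  have assoc: "nt_vcomp A f1 \<tau> (nt_vcomp A f1 \<sigma> \<delta>) = nt_vcomp A f1 (nt_vcomp A f2 \<tau> \<sigma>) \<delta>"
    if f: "compatible_system A B f1" "compatible_system A B f2" "compatible_system A B f3"
        "compatible_system A B f4"
      and \<delta>: "natural_transformation A B f1 f2 \<delta>" and \<sigma>: "natural_transformation A B f2 f3 \<sigma>"
      and \<tau>: "natural_transformation A B f3 f4 \<tau>"
    for f1 f2 f3 f4 \<delta> \<sigma> \<tau>
  proof -
    note v = natural_transformation_vcomp[OF B]
    show ?thesis
      using v[OF f(1,3,4) v[OF f(1-3) \<delta> \<sigma>] \<tau>] v[OF f(1,2,4) \<delta> v[OF f(2-4) \<sigma> \<tau>]]
      by (rule nt_eqI) (simp add: nt_vcomp_apply embeddings_in[OF nt_embedding[OF \<delta>]])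
  qed
  show ?thesis
    using unit assoc natural_transformation_id[OF B] natural_transformation_vcomp[OF B]
    by (simp add: is_category_def Pre_Orb_def)
qed

lemma is_functor_hcomp:
  assumes A: "orbifold_atlas A" and B: "orbifold_atlas B" and C: "orbifold_atlas C"
  shows "is_functor (prod_cat (t_hom Pre_Orb B C) (t_hom Pre_Orb A B)) (t_hom Pre_Orb A C)
    (\<lambda>(g, f). t_comp Pre_Orb A B C g f)
    (\<lambda>(g1, f1) (g2, f2) (\<eta>, \<delta>). t_hcomp Pre_Orb A B C g1 f1 g2 f2 \<eta> \<delta>)"
  using compatible_system_comp[OF A B] natural_transformation_hcomp[OF A B C] nt_hcomp_id nt_interchange
  by (auto simp: is_functor_def prod_cat_def Pre_Orb_def)

theorem proposition1p32:
  shows "strict_2_category (Pre_Orb :: ('a atlas, 'a csys, 'a ntrans) two_cat)"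
proof -
  have [simp]: "A \<in> t_obj Pre_Orb \<longleftrightarrow> orbifold_atlas A" "t_id Pre_Orb = cs_id"
    "t_comp Pre_Orb A B C g f = cs_comp A g f"
    "t_hcomp Pre_Orb A B C g1 f1 g2 f2 \<eta> \<delta> = nt_hcomp A g1 f1 f2 \<eta> \<delta>"
    "f \<in> c_obj (t_hom Pre_Orb A B) \<longleftrightarrow> compatible_system A B f"
    "\<delta> \<in> c_hom (t_hom Pre_Orb A B) f1 f2 \<longleftrightarrow> natural_transformation A B f1 f2 \<delta>"
    "c_id (t_hom Pre_Orb A B) f = nt_id A f"
    for A B C :: "'a atlas" and f g f1 f2 g1 g2 \<eta> \<delta>
    by (simp_all add: Pre_Orb_def)
  show ?thesis
    unfolding strict_2_category_def
  proof (intro conjI ballI)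
    fix A B C :: "'a atlas"
    assume "A \<in> t_obj Pre_Orb" "B \<in> t_obj Pre_Orb" "C \<in> t_obj Pre_Orb"
    then show "is_functor (prod_cat (t_hom Pre_Orb B C) (t_hom Pre_Orb A B)) (t_hom Pre_Orb A C)
        (\<lambda>(g, f). t_comp Pre_Orb A B C g f)
        (\<lambda>(g1, f1) (g2, f2) (\<eta>, \<delta>). t_hcomp Pre_Orb A B C g1 f1 g2 f2 \<eta> \<delta>)"
      by (intro is_functor_hcomp) simp_all
  qed (simp_all add: is_category_hom compatible_system_id cs_comp_id_left cs_comp_id_right
      cs_comp_assoc nt_hcomp_id_left nt_hcomp_id_right nt_hcomp_assoc)
qed

end
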